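(* Let $\rho_{AB}$ be a density operator on $\mathcal{H}_A\otimes\mathcal{H}_B$ with $d_A=d_B=d$ and with ordered operator Schmidt coefficients $r_1\ge r_2\ge\dots\ge r_{d^2}\ge0$. If $\sum_{i} r_i\le 1$ (in other words, if $\rho_{AB}$ passes the realignment criterion for separability), then $$\mathrm{CDP}_A(\rho_{AB})\le r_{\mathrm{CN}}\,d<\frac1d,\qquad\text{where } r_{\mathrm{CN}}=\frac{d(d^2-1)-\sqrt{d^2-1}}{d(d^2-1)^2+d^3}.$$
   Context: All Hilbert spaces are finite dimensional; $d_X=\dim\mathcal{H}_X$, and $\mathcal{L}(\mathcal{H})$ is the space of linear operators on $\mathcal{H}$. The operator Schmidt coefficients of $\rho_{AB}$ are the $d^2$ singular values (counted with multiplicity, zeros included) of the correlation matrix $C_{ij}=\mathrm{Tr}\big((F_i\otimes G_j)^\dagger\rho_{AB}\big)$, where $\{F_i\}$ and $\{G_j\}$ are arbitrary Hilbert–Schmidt orthonormal bases of $\mathcal{L}(\mathcal{H}_A)$ and $\mathcal{L}(\mathcal{H}_B)$. A quantum channel is a completely positive trace-preserving linear map $\mathcal{L}(\mathcal{H}_X)\to\mathcal{L}(\mathcal{H}_Y)$. Let $D(\rho,\sigma)=\frac12\|\rho-\sigma\|_1$. For channels $\Lambda_0,\Lambda_1$ with the same input system $S$ and the same output system, $D_\diamond(\Lambda_0,\Lambda_1)=\max_{\rho}D\big((\Lambda_0\otimes\mathrm{id}_{S'})[\rho],(\Lambda_1\otimes\mathrm{id}_{S'})[\rho]\big)$, the maximum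 being over all density operators on $\mathcal{H}_S\otimes\mathcal{H}_{S'}$, with $S'$ a copy of $S$. The channel discrimination power on $A$ is $$\mathrm{CDP}_A(\rho_{AB})=\inf_{\Lambda_0\neq\Lambda_1}\frac{D\big((\Lambda_0\otimes\mathrm{id}_B)[\rho_{AB}],(\Lambda_1\otimes\mathrm{id}_B)[\rho_{AB}]\big)}{D_\diamond(\Lambda_0,\Lambda_1)},$$ the infimum being over all pairs of distinct channels with input $\mathcal{L}(\mathcal{H}_A)$ and a common output space of arbitrary finite dimension.
   Formalization: The formal theorem assumes d ≥ 2; for d = 1 the claim is false, since the only state ρ = 1 has r_1 = 1 and CDP_A = 1, while r_CN·d = 0. *)

theory Defs
  imports "Jordan_Normal_Form.Schur_Decomposition"
begin

(* A Hilbert space of dimension n is C^n, its operators are the n x n complex matrices,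
   and C^n (x) C^k is C^(n*k) with basis vector e_i (x) e_b at position i * k + b. *)

definition mtrace :: "complex mat \<Rightarrow> complex" where
  "mtrace A = (\<Sum>i<dim_row A. A $$ (i, i))"

definition kron :: "complex mat \<Rightarrow> complex mat \<Rightarrow> complex mat" where
  "kron A B = mat (dim_row A * dim_row B) (dim_col A * dim_col B)
     (\<lambda>(p, q). A $$ (p div dim_row B, q div dim_col B) * B $$ (p mod dim_row B, q mod dim_col B))"

(* "0 \<le> z" for complex z means that z is real and nonnegative, so A is in particular Hermitian. *)
definition psd :: "nat \<Rightarrow> complex mat \<Rightarrow> bool" where
  "psd n A \<longleftrightarrow> A \<in> carrier_mat n n \<and> (\<forall>v \<in> carrier_vec n. 0 \<le> (A *\<^sub>v v) \<bullet>c v)"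

definition density_operator :: "nat \<Rightarrow> complex mat \<Rightarrow> bool" where
  "density_operator n \<rho> \<longleftrightarrow> psd n \<rho> \<and> mtrace \<rho> = 1"

(* The roots of the characteristic polynomial, with multiplicity, are the eigenvalues of
   M^* M with algebraic multiplicity; zeros are included. *)
definition singular_values :: "complex mat \<Rightarrow> real multiset" where
  "singular_values M = image_mset (\<lambda>z. sqrt (Re z)) (proots (char_poly (mat_adjoint M * M)))"

definition trace_norm :: "complex mat \<Rightarrow> real" where
  "trace_norm M = sum_mset (singular_values M)"

definition trace_dist :: "complex mat \<Rightarrow> complex mat \<Rightarrow> real" where
  "trace_dist \<rho> \<sigma> = trace_norm (\<rho> - \<sigma>) / 2"

definition hs_inner :: "complex mat \<Rightarrow> complex mat \<Rightarrow> complex" where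
  "hs_inner A B = mtrace (mat_adjoint A * B)"

definition hs_orthonormal_basis :: "nat \<Rightarrow> (nat \<Rightarrow> complex mat) \<Rightarrow> bool" where
  "hs_orthonormal_basis d F \<longleftrightarrow>
     (\<forall>i<d^2. F i \<in> carrier_mat d d) \<and>
     (\<forall>i<d^2. \<forall>j<d^2. hs_inner (F i) (F j) = (if i = j then 1 else 0)) \<and>
     (\<forall>X \<in> carrier_mat d d. \<exists>c. \<forall>a<d. \<forall>b<d. X $$ (a, b) = (\<Sum>i<d^2. c i * F i $$ (a, b)))"

definition correlation_matrix ::
  "nat \<Rightarrow> (nat \<Rightarrow> complex mat) \<Rightarrow> (nat \<Rightarrow> complex mat) \<Rightarrow> complex mat \<Rightarrow> complex mat" where
  "correlation_matrix d F G \<rho> = mat (d^2) (d^2) (\<lambda>(i, j). hs_inner (kron (F i) (G j)) \<rho>)"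

definition operator_schmidt_coeffs ::
  "nat \<Rightarrow> (nat \<Rightarrow> complex mat) \<Rightarrow> (nat \<Rightarrow> complex mat) \<Rightarrow> complex mat \<Rightarrow> real multiset" where
  "operator_schmidt_coeffs d F G \<rho> = singular_values (correlation_matrix d F G \<rho>)"

definition linear_map :: "nat \<Rightarrow> nat \<Rightarrow> (complex mat \<Rightarrow> complex mat) \<Rightarrow> bool" where
  "linear_map n m \<Lambda> \<longleftrightarrow>
     (\<forall>X \<in> carrier_mat n n. \<Lambda> X \<in> carrier_mat m m) \<and>
     (\<forall>X \<in> carrier_mat n n. \<forall>Y \<in> carrier_mat n n. \<Lambda> (X + Y) = \<Lambda> X + \<Lambda> Y) \<and>
     (\<forall>c. \<forall>X \<in> carrier_mat n n. \<Lambda> (c \<cdot>\<^sub>m X) = c \<cdot>\<^sub>m \<Lambda> X)"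

(* For \<rho> on C^n (x) C^k, the operator X_bc on C^n with \<rho> = sum over b, c of X_bc (x) |b><c|. *)
definition block :: "nat \<Rightarrow> nat \<Rightarrow> nat \<Rightarrow> nat \<Rightarrow> complex mat \<Rightarrow> complex mat" where
  "block n k b c \<rho> = mat n n (\<lambda>(i, j). \<rho> $$ (i * k + b, j * k + c))"

(* The map \<Lambda> (x) id_k, i.e. the sum over b, c of \<Lambda> X_bc (x) |b><c|; see ampliation_kron below. *)
definition ampliation ::
  "nat \<Rightarrow> nat \<Rightarrow> nat \<Rightarrow> (complex mat \<Rightarrow> complex mat) \<Rightarrow> complex mat \<Rightarrow> complex mat" where
  "ampliation n m k \<Lambda> \<rho> = mat (m * k) (m * k)
     (\<lambda>(p, q). \<Lambda> (block n k (p mod k) (q mod k) \<rho>) $$ (p div k, q div k))"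

definition completely_positive :: "nat \<Rightarrow> nat \<Rightarrow> (complex mat \<Rightarrow> complex mat) \<Rightarrow> bool" where
  "completely_positive n m \<Lambda> \<longleftrightarrow>
     (\<forall>k \<rho>. psd (n * k) \<rho> \<longrightarrow> psd (m * k) (ampliation n m k \<Lambda> \<rho>))"

definition quantum_channel :: "nat \<Rightarrow> nat \<Rightarrow> (complex mat \<Rightarrow> complex mat) \<Rightarrow> bool" where
  "quantum_channel n m \<Lambda> \<longleftrightarrow> linear_map n m \<Lambda> \<and> completely_positive n m \<Lambda> \<and>
     (\<forall>X \<in> carrier_mat n n. mtrace (\<Lambda> X) = mtrace X)"

(* For channels the supremum is a maximum, by compactness. *)
definition diamond_dist ::
  "nat \<Rightarrow> nat \<Rightarrow> (complex mat \<Rightarrow> complex mat) \<Rightarrow> (complex mat \<Rightarrow> complex mat) \<Rightarrow> real" where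
  "diamond_dist n m \<Lambda>\<^sub>0 \<Lambda>\<^sub>1 =
     (SUP \<rho> \<in> {\<rho>. density_operator (n * n) \<rho>}.
        trace_dist (ampliation n m n \<Lambda>\<^sub>0 \<rho>) (ampliation n m n \<Lambda>\<^sub>1 \<rho>))"

(* Distinctness is distinctness on the n x n matrices: HOL functions that differ only
   outside the carrier are the same channel. *)
definition distinct_channels ::
  "nat \<Rightarrow> nat \<Rightarrow> (complex mat \<Rightarrow> complex mat) \<Rightarrow> (complex mat \<Rightarrow> complex mat) \<Rightarrow> bool" where
  "distinct_channels n m \<Lambda>\<^sub>0 \<Lambda>\<^sub>1 \<longleftrightarrow> quantum_channel n m \<Lambda>\<^sub>0 \<and> quantum_channel n m \<Lambda>\<^sub>1 \<and>
     (\<exists>X \<in> carrier_mat n n. \<Lambda>\<^sub>0 X \<noteq> \<Lambda>\<^sub>1 X)"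

definition CDP_A :: "nat \<Rightarrow> nat \<Rightarrow> complex mat \<Rightarrow> real" where
  "CDP_A dA dB \<rho> = Inf {trace_dist (ampliation dA m dB \<Lambda>\<^sub>0 \<rho>) (ampliation dA m dB \<Lambda>\<^sub>1 \<rho>)
                         / diamond_dist dA m \<Lambda>\<^sub>0 \<Lambda>\<^sub>1 | m \<Lambda>\<^sub>0 \<Lambda>\<^sub>1. distinct_channels dA m \<Lambda>\<^sub>0 \<Lambda>\<^sub>1}"

definition r_CN :: "nat \<Rightarrow> real" where
  "r_CN d = (real d * (real d ^ 2 - 1) - sqrt (real d ^ 2 - 1))
              / (real d * (real d ^ 2 - 1) ^ 2 + real d ^ 3)"

lemma ampliation_kron:
  assumes L: "linear_map n m \<Lambda>" and X: "X \<in> carrier_mat n n" and Y: "Y \<in> carrier_mat k k"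
  shows "ampliation n m k \<Lambda> (kron X Y) = kron (\<Lambda> X) Y"
proof -
  have C: "\<Lambda> X \<in> carrier_mat m m" using L X unfolding linear_map_def by blast
  have lt: "i * k + b < n * k" if "i < n" "b < k" for i b :: nat
  proof -
    have "i * k + b < Suc i * k" using that by simp
    also have "\<dots> \<le> n * k" using that by (intro mult_le_mono1) simp
    finally show ?thesis .
  qed
  have B: "block n k b c (kron X Y) = Y $$ (b, c) \<cdot>\<^sub>m X" if "b < k" "c < k" for b c
    using X Y that lt by (intro eq_matI) (auto simp: block_def kron_def)
  show ?thesis
  proof (intro eq_matI)
    fix p q assume "p < dim_row (kron (\<Lambda> X) Y)" "q < dim_col (kron (\<Lambda> X) Y)"
    then have pq: "p < m * k" "q < m * k" using C Y by (auto simp: kron_def)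
    then have k: "k > 0" by (cases k) auto
    have d: "p div k < m" "q div k < m"
      using pq by (simp_all add: less_mult_imp_div_less)
    have "\<Lambda> (Y $$ (p mod k, q mod k) \<cdot>\<^sub>m X) = Y $$ (p mod k, q mod k) \<cdot>\<^sub>m \<Lambda> X"
      using L X unfolding linear_map_def by blast
    then show "ampliation n m k \<Lambda> (kron X Y) $$ (p, q) = kron (\<Lambda> X) Y $$ (p, q)"
      using pq k d C Y B[of "p mod k" "q mod k"] by (simp add: ampliation_def kron_def)
  qed (use C Y in \<open>auto simp: ampliation_def kron_def\<close>)
qed

end

(* A channel pair that prepares |0><0| or |1><1| after a weak measurement of a Hermitian observable
   F has ratio at most sqrt d |Tr_A (F rho)|_2 / |<v|F|v>| for every unit vector v, and v can be
   chosen with |<v|F|v>| at least |F|_2 / sqrt d. Taking F along a singular direction of the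
   correlation matrix gives CDP <= d r_i for every i, which settles the case where some r_i is at
   most r_CN. If instead all r_i exceed r_CN, then sum r_i <= 1 bounds sum r_i^2 = |rho|_2^2 from
   above, while the marginal on B already accounts for at least 1/d^2 of it; averaging over the
   traceless F leaves one with |Tr_A (F rho)|_2 <= q |F|_2, where q = 1/(d (d + 1)). This q is at
   most r_CN for d >= 3 but not for d = 2: the symmetric two-qubit Werner state has
   r_2 = r_3 = r_4 = 1/6 > r_CN. For qubits F is therefore tilted towards the identity. *)

theory Submission
  imports Defs
begin

section \<open>Singular values and the trace norm\<close>

text \<open>\<open>frob2\<close> is the squared norm \<open>|.|_2^2\<close>. The weak measurement
  has effects \<open>1/2 + a F\<close> and \<open>1/2 - a F\<close>; the strength \<open>a\<close>
  only has to keep them positive and cancels from the ratio. One factor \<open>sqrt d\<close> is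
  lost to Cauchy-Schwarz between the trace norm and \<open>|.|_2\<close> on B, the other to the
  spread of the spectrum of \<open>F\<close>. An observable must be Hermitian, but a singular
  direction or a matrix unit need not be. Bounds are therefore found for arbitrary \<open>X\<close>
  and then passed to one of its Hermitian components, which works because \<open>rho\<close> is
  Hermitian. Origin of \<open>q\<close>: under \<open>r_i >= q\<close> and
  \<open>sum r_i <= 1\<close>, convexity makes \<open>sum r_i^2\<close> largest at
  \<open>(1 - (d^2 - 1) q, q, ..., q)\<close>. The value \<open>q = 1/(d (d + 1))\<close> makes the
  first entry \<open>1/d\<close>, whose square is exactly the share \<open>1/d^2\<close> of the
  marginal; the \<open>d^2 - 1\<close> traceless directions are left with \<open>q^2\<close> on
  average. These are the coefficients of \<open>(1 + SWAP)/(d (d + 1))\<close>, so the estimate of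
  \<open>sum r_i^2\<close> cannot be improved and for \<open>d = 2\<close> the observable itself has
  to change.\<close>

definition frob2 :: "complex mat \<Rightarrow> real" where
  "frob2 A = (\<Sum>i<dim_row A. \<Sum>j<dim_col A. (cmod (A $$ (i, j)))\<^sup>2)"

definition vnorm2 :: "complex vec \<Rightarrow> real" where
  "vnorm2 v = (\<Sum>i<dim_vec v. (cmod (v $ i))\<^sup>2)"

lemma frob2_nonneg: "0 \<le> frob2 A"
  unfolding frob2_def by (intro sum_nonneg) auto

lemma vnorm2_nonneg: "0 \<le> vnorm2 v"
  unfolding vnorm2_def by (intro sum_nonneg) auto

lemma vnorm2_eq_0_iff:
  assumes "v \<in> carrier_vec n"
  shows "vnorm2 v = 0 \<longleftrightarrow> v = 0\<^sub>v n"
  using assms unfolding vnorm2_def by (subst sum_nonneg_eq_0_iff) auto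

lemma vnorm2_cscalar_prod: "complex_of_real (vnorm2 v) = v \<bullet>c v"
  by (simp add: vnorm2_def scalar_prod_def complex_norm_square atLeast0LessThan flip: of_real_power)

lemma mat_adjoint_carrier [simp]: "A \<in> carrier_mat n m \<Longrightarrow> mat_adjoint A \<in> carrier_mat m n"
  by (simp add: mat_adjoint_def mat_of_rows_def)

lemma mat_adjoint_dim [simp]:
  "dim_row (mat_adjoint A) = dim_col A" "dim_col (mat_adjoint A) = dim_row A"
  by (simp_all add: mat_adjoint_def)

lemma mat_adjoint_index [simp]:
  fixes A :: "complex mat"
  assumes "i < dim_col A" "j < dim_row A"
  shows "mat_adjoint A $$ (i, j) = cnj (A $$ (j, i))"
  using assms by (simp add: mat_adjoint_def mat_of_rows_index)

lemma cscalar_prod_adjoint: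
  fixes A :: "complex mat"
  assumes A: "A \<in> carrier_mat n m" and u: "u \<in> carrier_vec n" and v: "v \<in> carrier_vec m"
  shows "(mat_adjoint A *\<^sub>v u) \<bullet>c v = u \<bullet>c (A *\<^sub>v v)"
proof -
  have "(mat_adjoint A *\<^sub>v u) \<bullet>c v = (\<Sum>j<m. \<Sum>i<n. cnj (A $$ (i, j)) * u $ i * cnj (v $ j))"
    using assms by (auto simp: scalar_prod_def atLeast0LessThan sum_distrib_right intro!: sum.cong)
  also have "\<dots> = (\<Sum>i<n. \<Sum>j<m. cnj (A $$ (i, j)) * u $ i * cnj (v $ j))"
    by (rule sum.swap)
  also have "\<dots> = u \<bullet>c (A *\<^sub>v v)"
    using assms by (auto simp: scalar_prod_def atLeast0LessThan sum_distrib_left mult_ac intro!: sum.cong)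
  finally show ?thesis .
qed

lemma mtrace_mult_comm:
  assumes "A \<in> carrier_mat n m" "B \<in> carrier_mat m n"
  shows "mtrace (A * B) = mtrace (B * A)"
proof -
  have "mtrace (A * B) = (\<Sum>i<n. \<Sum>j<m. A $$ (i, j) * B $$ (j, i))"
    using assms by (auto simp: mtrace_def scalar_prod_def atLeast0LessThan intro!: sum.cong)
  also have "\<dots> = (\<Sum>j<m. \<Sum>i<n. A $$ (i, j) * B $$ (j, i))" by (rule sum.swap)
  also have "\<dots> = mtrace (B * A)"
    using assms by (auto simp: mtrace_def scalar_prod_def atLeast0LessThan mult.commute intro!: sum.cong)
  finally show ?thesis .
qed

lemma mtrace_adjoint_mult: "mtrace (mat_adjoint A * A) = complex_of_real (frob2 A)"
proof -
  have "mtrace (mat_adjoint A * A) = (\<Sum>j<dim_col A. \<Sum>i<dim_row A. cnj (A $$ (i, j)) * A $$ (i, j))"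
    by (auto simp: mtrace_def scalar_prod_def atLeast0LessThan intro!: sum.cong)
  also have "\<dots> = (\<Sum>i<dim_row A. \<Sum>j<dim_col A. cnj (A $$ (i, j)) * A $$ (i, j))"
    by (rule sum.swap)
  also have "\<dots> = complex_of_real (frob2 A)"
    unfolding frob2_def by (simp add: complex_norm_square mult.commute flip: of_real_power)
  finally show ?thesis .
qed

lemma frob2_adjoint: "frob2 (mat_adjoint A) = frob2 A"
proof -
  have "frob2 (mat_adjoint A) = (\<Sum>j<dim_col A. \<Sum>i<dim_row A. (cmod (A $$ (i, j)))\<^sup>2)"
    by (auto simp: frob2_def intro!: sum.cong)
  also have "\<dots> = frob2 A" unfolding frob2_def by (rule sum.swap)
  finally show ?thesis .
qed

lemma proots_linear_factors:
  "proots (\<Prod>a\<leftarrow>es. [:- a, 1:]) = mset (es :: 'a :: idom list)"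
proof (induction es)
  case (Cons a es)
  have "(\<Prod>a\<leftarrow>es. [:- a, 1:]) \<noteq> 0" by (auto simp: prod_list_zero_iff)
  then show ?case using Cons by (simp add: proots_mult del: mult_pCons_left)
qed simp

text \<open>Schur triangularization puts the roots, with multiplicity, on the diagonal of a similar
  matrix, and the trace is invariant under similarity.\<close>

lemma sum_proots_char_poly:
  assumes A: "A \<in> carrier_mat n n"
  shows "size (proots (char_poly A)) = n" and "sum_mset (proots (char_poly A)) = mtrace A"
proof -
  obtain es where es: "char_poly A = (\<Prod>a\<leftarrow>es. [:- a, 1:])" and len: "length es = n"
    using char_poly_factorized[OF A] by blast
  obtain B P Q where s: "schur_decomposition A es = (B, P, Q)" by (metis prod_cases3)
  have w: "similar_mat_wit A B P Q" and d: "diag_mat B = es"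
    using schur_decomposition[OF A es s] by auto
  have c: "B \<in> carrier_mat n n" "P \<in> carrier_mat n n" "Q \<in> carrier_mat n n"
      "Q * P = 1\<^sub>m n" "A = P * B * Q"
    using w A unfolding similar_mat_wit_def Let_def by auto
  have "mtrace A = mtrace (P * (B * Q))" using c by simp
  also have "\<dots> = mtrace (B * Q * P)" using c by (intro mtrace_mult_comm) auto
  also have "\<dots> = mtrace B" using c by (simp add: assoc_mult_mat[of B n n Q n P n])
  also have "\<dots> = sum_list (diag_mat B)"
    unfolding mtrace_def diag_mat_def by (simp add: sum_list_distinct_conv_sum_set atLeast0LessThan)
  finally show "sum_mset (proots (char_poly A)) = mtrace A"
    by (simp add: es proots_linear_factors d sum_mset_sum_list)
  show "size (proots (char_poly A)) = n" by (simp add: es proots_linear_factors len)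
qed

lemma proots_char_poly_eigenvector:
  fixes A :: "complex mat"
  assumes A: "A \<in> carrier_mat n n" and z: "z \<in># proots (char_poly A)"
  obtains v where "v \<in> carrier_vec n" "v \<noteq> 0\<^sub>v n" "A *\<^sub>v v = z \<cdot>\<^sub>v v"
proof -
  have "poly (char_poly A) z = 0" using z by (cases "char_poly A = 0") auto
  then have "eigenvalue A z" using eigenvalue_root_char_poly[OF A] by blast
  then show ?thesis using that A unfolding eigenvalue_def eigenvector_def by auto
qed

text \<open>An eigenvector \<open>v\<close> of \<open>M^* M\<close> satisfies
  \<open>|M v|^2 = z |v|^2\<close>, so \<open>z\<close> is a quotient of squared norms; hence
  \<open>Re\<close> and \<open>sqrt\<close> in \<open>singular_values\<close> lose nothing. The
  eigenvector is kept for the extraction of singular directions.\<close>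

lemma proots_gram:
  assumes M: "M \<in> carrier_mat m n" and z: "z \<in># proots (char_poly (mat_adjoint M * M))"
  shows "z = complex_of_real (Re z)" and "0 \<le> Re z"
    and "\<exists>v \<in> carrier_vec n. v \<noteq> 0\<^sub>v n \<and> mat_adjoint M *\<^sub>v (M *\<^sub>v v) = z \<cdot>\<^sub>v v \<and>
           vnorm2 (M *\<^sub>v v) = Re z * vnorm2 v"
proof -
  have "mat_adjoint M * M \<in> carrier_mat n n" using M by (intro mult_carrier_mat) auto
  then obtain v where v: "v \<in> carrier_vec n" "v \<noteq> 0\<^sub>v n" "(mat_adjoint M * M) *\<^sub>v v = z \<cdot>\<^sub>v v"
    using z by (rule proots_char_poly_eigenvector)
  have e: "mat_adjoint M *\<^sub>v (M *\<^sub>v v) = z \<cdot>\<^sub>v v"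
    using v M by (metis assoc_mult_mat_vec mat_adjoint_carrier)
  have "complex_of_real (vnorm2 (M *\<^sub>v v)) = (mat_adjoint M *\<^sub>v (M *\<^sub>v v)) \<bullet>c v"
    using v M by (simp add: vnorm2_cscalar_prod cscalar_prod_adjoint[of M m n])
  also have "\<dots> = z * complex_of_real (vnorm2 v)"
    using v by (simp add: e vnorm2_cscalar_prod)
  finally have eq: "complex_of_real (vnorm2 (M *\<^sub>v v)) = z * complex_of_real (vnorm2 v)" .
  have pos: "vnorm2 v > 0"
    using v vnorm2_eq_0_iff[of v n] vnorm2_nonneg[of v] by auto
  then have z': "z = complex_of_real (vnorm2 (M *\<^sub>v v) / vnorm2 v)"
    using eq by (simp add: field_simps)
  show "z = complex_of_real (Re z)" using z' by (metis Re_complex_of_real)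
  show "0 \<le> Re z" using z' vnorm2_nonneg by (metis Re_complex_of_real divide_nonneg_nonneg)
  have "vnorm2 (M *\<^sub>v v) = Re z * vnorm2 v" using z' pos by simp
  then show "\<exists>v \<in> carrier_vec n. v \<noteq> 0\<^sub>v n \<and> mat_adjoint M *\<^sub>v (M *\<^sub>v v) = z \<cdot>\<^sub>v v \<and>
           vnorm2 (M *\<^sub>v v) = Re z * vnorm2 v"
    using v e by blast
qed

lemma sum_mset_Re: "Re (sum_mset Z) = sum_mset (image_mset Re Z)"
  by (induction Z) auto

lemma singular_values_facts:
  assumes M: "M \<in> carrier_mat m n"
  shows "size (singular_values M) = n"
    and "\<And>s. s \<in># singular_values M \<Longrightarrow> 0 \<le> s"
    and "(\<Sum>s\<in>#singular_values M. s\<^sup>2) = frob2 M"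
proof -
  have c: "mat_adjoint M * M \<in> carrier_mat n n" using M by (intro mult_carrier_mat) auto
  let ?Z = "proots (char_poly (mat_adjoint M * M))"
  show "size (singular_values M) = n"
    unfolding singular_values_def by (simp add: sum_proots_char_poly[OF c])
  show "\<And>s. s \<in># singular_values M \<Longrightarrow> 0 \<le> s"
    unfolding singular_values_def using proots_gram(2)[OF M] by auto
  have "(\<Sum>s\<in>#singular_values M. s\<^sup>2) = (\<Sum>z\<in>#?Z. (sqrt (Re z))\<^sup>2)"
    unfolding singular_values_def by (simp add: image_mset.compositionality comp_def)
  also have "\<dots> = (\<Sum>z\<in>#?Z. Re z)"
    using proots_gram(2)[OF M] by (intro arg_cong[of _ _ sum_mset] image_mset_cong) simp
  also have "\<dots> = frob2 M"
    using sum_proots_char_poly(2)[OF c] by (simp add: sum_mset_Re[symmetric] mtrace_adjoint_mult)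
  finally show "(\<Sum>s\<in>#singular_values M. s\<^sup>2) = frob2 M" .
qed

text \<open>Nonnegativity of the variance: the sum of \<open>(s - c)^2\<close> is expanded and
  evaluated at the mean.\<close>

lemma sum_mset_Cauchy_Schwarz:
  fixes S :: "real multiset"
  shows "(sum_mset S)\<^sup>2 \<le> real (size S) * (\<Sum>s\<in>#S. s\<^sup>2)"
proof -
  have var: "(\<Sum>s\<in>#S. (s - c)\<^sup>2) = (\<Sum>s\<in>#S. s\<^sup>2) - 2 * c * sum_mset S + real (size S) * c\<^sup>2" for c
    by (induction S) (auto simp: algebra_simps power2_eq_square)
  have nn: "0 \<le> (\<Sum>s\<in>#S. (s - c)\<^sup>2)" for c by (induction S) auto
  show ?thesis
  proof (cases "size S = 0")
    case False
    define k where "k = real (size S)"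
    have k: "k > 0" unfolding k_def using False by (simp only: of_nat_0_less_iff)
    have "0 \<le> k * ((\<Sum>s\<in>#S. s\<^sup>2) - 2 * (sum_mset S / k) * sum_mset S + k * (sum_mset S / k)\<^sup>2)"
      using nn[of "sum_mset S / k"] var[of "sum_mset S / k"] k unfolding k_def[symmetric] by simp
    also have "\<dots> = k * (\<Sum>s\<in>#S. s\<^sup>2) - (sum_mset S)\<^sup>2"
    proof -
      have "k * (q - 2 * (t / k) * t + k * (t / k)\<^sup>2) = k * q - t\<^sup>2" for q t :: real
        using k by (simp add: field_simps power2_eq_square)
      then show ?thesis .
    qed
    finally show ?thesis by (simp add: k_def)
  qed simp
qed

lemma trace_norm_nonneg: "0 \<le> trace_norm M"
proof -
  have "0 \<le> sum_mset S" if "\<And>s. s \<in># S \<Longrightarrow> 0 \<le> s" for S :: "real multiset"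
    using that by (induction S) (auto simp: add_nonneg_nonneg)
  then show ?thesis
    unfolding trace_norm_def using singular_values_facts(2)[OF carrier_matI[OF refl refl], of _ M] by blast
qed

lemma trace_norm_le:
  assumes "M \<in> carrier_mat m n"
  shows "trace_norm M \<le> sqrt (real n * frob2 M)"
  using sum_mset_Cauchy_Schwarz[of "singular_values M"] singular_values_facts[OF assms]
  by (simp add: trace_norm_def real_le_rsqrt)

text \<open>\<open>trace_norm_le\<close> only bounds from above; the lower bound on the diamond
  distance needs one trace norm computed exactly.\<close>

lemma trace_norm_real_diagonal:
  assumes M: "M = mat n n (\<lambda>(i, j). if i = j then complex_of_real (f i) else 0)"
  shows "trace_norm M = (\<Sum>i<n. \<bar>f i\<bar>)"
proof -
  let ?D = "mat_adjoint M * M"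
  have D: "?D = mat n n (\<lambda>(i, j). if i = j then complex_of_real ((f i)\<^sup>2) else 0)"
    unfolding M
    by (intro eq_matI) (auto simp: scalar_prod_def if_distrib[of "\<lambda>x. x * _"] if_distrib[of cnj]
        power2_eq_square cong: if_cong)
  have ut: "upper_triangular ?D" unfolding D by (auto simp: upper_triangular_def)
  have "char_poly ?D = (\<Prod>a\<leftarrow>diag_mat ?D. [:- a, 1:])"
    by (rule char_poly_upper_triangular[of _ n]) (use ut M in \<open>auto simp: D\<close>)
  then have "proots (char_poly ?D) = mset (map (\<lambda>i. complex_of_real ((f i)\<^sup>2)) [0..<n])"
    by (simp add: proots_linear_factors) (auto simp: diag_mat_def D intro!: image_mset_cong)
  then have "singular_values M = image_mset (\<lambda>i. \<bar>f i\<bar>) (mset [0..<n])"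
    unfolding singular_values_def by (simp add: image_mset.compositionality comp_def)
  then have "trace_norm M = sum_list (map (\<lambda>i. \<bar>f i\<bar>) [0..<n])"
    unfolding trace_norm_def by (metis mset_map sum_mset_sum_list)
  then show ?thesis by (simp add: sum_list_distinct_conv_sum_set atLeast0LessThan)
qed

text \<open>Splits a tensor product index as \<open>p = s * k + b\<close>, the convention of
  \<open>kron\<close> and \<open>ampliation\<close>.\<close>

lemma sum_lessThan_mult:
  fixes f :: "nat \<Rightarrow> 'a :: comm_monoid_add"
  shows "(\<Sum>p<m * k. f p) = (\<Sum>s<m. \<Sum>b<k. f (s * k + b))"
proof -
  have "(\<Sum>p<m * k. f p) = (\<Sum>s<m. sum f {s * k..<s * k + k})"
    by (simp add: sum.nat_group)
  also have "\<dots> = (\<Sum>s<m. \<Sum>b<k. f (s * k + b))"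
  proof (rule sum.cong[OF refl])
    fix s
    show "sum f {s * k..<s * k + k} = (\<Sum>b<k. f (s * k + b))"
      using sum.shift_bounds_nat_ivl[of f 0 "s * k" k] by (simp add: atLeast0LessThan add.commute)
  qed
  finally show ?thesis .
qed

lemma pair_index_less: "i < n \<Longrightarrow> b < k \<Longrightarrow> i * k + b < n * (k :: nat)"
proof -
  assume "i < n" "b < k"
  then have "i * k + b < Suc i * k" by simp
  also have "\<dots> \<le> n * k" using \<open>i < n\<close> by (intro mult_le_mono1) simp
  finally show ?thesis .
qed

section \<open>Positive semidefinite matrices and channels\<close>

lemma psd_iff:
  "psd n A \<longleftrightarrow> A \<in> carrier_mat n n \<and>
     (\<forall>v :: nat \<Rightarrow> complex. 0 \<le> (\<Sum>i<n. \<Sum>j<n. cnj (v i) * A $$ (i, j) * v j))"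
proof (cases "A \<in> carrier_mat n n")
  case A: True
  have form: "(A *\<^sub>v v) \<bullet>c v = (\<Sum>i<n. \<Sum>j<n. cnj (v $ i) * A $$ (i, j) * v $ j)"
    if "v \<in> carrier_vec n" for v
    using A that
    by (auto simp: scalar_prod_def atLeast0LessThan sum_distrib_right sum_distrib_left mult_ac intro!: sum.cong)
  show ?thesis
  proof
    assume P: "psd n A"
    have "0 \<le> (\<Sum>i<n. \<Sum>j<n. cnj (v i) * A $$ (i, j) * v j)" for v :: "nat \<Rightarrow> complex"
    proof -
      have "0 \<le> (A *\<^sub>v vec n v) \<bullet>c vec n v" using P unfolding psd_def by simp
      then show ?thesis by (simp add: form)
    qed
    then show "A \<in> carrier_mat n n \<and>
     (\<forall>v :: nat \<Rightarrow> complex. 0 \<le> (\<Sum>i<n. \<Sum>j<n. cnj (v i) * A $$ (i, j) * v j))"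
      using A by blast
  qed (auto simp: psd_def form)
qed (simp add: psd_def)

lemma mtrace_mult:
  assumes "A \<in> carrier_mat n m" "B \<in> carrier_mat m n"
  shows "mtrace (A * B) = (\<Sum>i<n. \<Sum>j<m. A $$ (i, j) * B $$ (j, i))"
  using assms by (auto simp: mtrace_def scalar_prod_def atLeast0LessThan intro!: sum.cong)

text \<open>The form is tested on vectors supported on the coordinates \<open>i\<close> and
  \<open>j\<close>. Its reality at \<open>(1, 1)\<close> and \<open>(1, \<i>)\<close> forces
  Hermiticity; a phase that turns both cross terms into \<open>- |A_ij|\<close> gives the entry
  bound.\<close>

lemma psd_hermitian_and_bound:
  assumes P: "psd n A" and i: "i < n" and j: "j < n"
  shows "A $$ (j, i) = cnj (A $$ (i, j))" and "0 \<le> A $$ (i, i)"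
    and "2 * cmod (A $$ (i, j)) \<le> Re (A $$ (i, i)) + Re (A $$ (j, j))"
proof -
  let ?q = "\<lambda>v. \<Sum>i<n. \<Sum>j<n. cnj (v i) * A $$ (i, j) * v j"
  have q: "0 \<le> ?q v" for v using P unfolding psd_iff by blast
  have two: "0 \<le> cnj a * a * A $$ (i, i) + cnj a * b * A $$ (i, j)
       + (cnj b * a * A $$ (j, i) + cnj b * b * A $$ (j, j))" for a b
  proof -
    \<comment> \<open>A sum of two indicators instead of nested cases, so that \<open>i = j\<close>
      is covered.\<close>
    let ?v = "\<lambda>k. (if k = i then a else 0) + (if k = j then b else 0)"
    have inner: "(\<Sum>l<n. cnj (?v k) * A $$ (k, l) * ?v l) = cnj (?v k) * (A $$ (k, i) * a + A $$ (k, j) * b)" for k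
    proof -
      have "(\<Sum>l<n. cnj (?v k) * A $$ (k, l) * ?v l)
          = cnj (?v k) * ((\<Sum>l<n. A $$ (k, l) * (if l = i then a else 0)) + (\<Sum>l<n. A $$ (k, l) * (if l = j then b else 0)))"
        by (simp only: sum_distrib_left distrib_left sum.distrib[symmetric] mult.assoc)
      then show ?thesis using i j by (simp add: if_distrib[of "\<lambda>x. _ * x"] cong: if_cong)
    qed
    have "?q ?v = (\<Sum>k<n. cnj (if k = i then a else 0) * (A $$ (k, i) * a + A $$ (k, j) * b))
         + (\<Sum>k<n. cnj (if k = j then b else 0) * (A $$ (k, i) * a + A $$ (k, j) * b))"
      unfolding inner by (simp only: complex_cnj_add distrib_right sum.distrib)
    also have "\<dots> = cnj a * (A $$ (i, i) * a + A $$ (i, j) * b) + cnj b * (A $$ (j, i) * a + A $$ (j, j) * b)"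
      using i j by (simp add: if_distrib[of "\<lambda>x. x * _"] if_distrib[of cnj] cong: if_cong)
    finally show ?thesis using q[of ?v] by (simp add: algebra_simps)
  qed
  have diag: "0 \<le> A $$ (i, i)" "0 \<le> A $$ (j, j)"
    using two[of 1 0] two[of 0 1] by simp_all
  then show "0 \<le> A $$ (i, i)" by blast
  have h: "A $$ (j, i) = cnj (A $$ (i, j))"
    using two[of 1 1] two[of 1 \<i>] diag
    by (auto simp: less_eq_complex_def complex_eq_iff)
  then show "A $$ (j, i) = cnj (A $$ (i, j))" .
  show "2 * cmod (A $$ (i, j)) \<le> Re (A $$ (i, i)) + Re (A $$ (j, j))"
  proof (cases "A $$ (i, j) = 0")
    case True
    then show ?thesis using diag by (simp add: less_eq_complex_def)
  next
    case False
    let ?x = "A $$ (i, j)"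
    let ?b = "- cnj ?x / complex_of_real (cmod ?x)"
    have c: "complex_of_real (cmod ?x) \<noteq> 0" using False by simp
    have xx: "cnj ?x * ?x = complex_of_real (cmod ?x) * complex_of_real (cmod ?x)"
      by (metis complex_norm_square mult.commute of_real_power power2_eq_square)
    have b1: "?b * ?x = - complex_of_real (cmod ?x)"
    proof -
      have "?b * ?x = - (cnj ?x * ?x) / complex_of_real (cmod ?x)" by simp
      then show ?thesis unfolding xx using c by simp
    qed
    have b2: "cnj ?b * cnj ?x = - complex_of_real (cmod ?x)"
      using arg_cong[OF b1, of cnj] by simp
    have b3: "cnj ?b * ?b = 1"
    proof -
      have "cnj ?b * ?b = (cnj ?x * ?x) / (complex_of_real (cmod ?x) * complex_of_real (cmod ?x))" by simp
      then show ?thesis unfolding xx using c by simp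
    qed
    have "0 \<le> A $$ (i, i) + ?b * ?x + (cnj ?b * cnj ?x + cnj ?b * ?b * A $$ (j, j))"
      using two[of 1 ?b] by (simp only: h complex_cnj_one mult_1 mult_1_right)
    then have "0 \<le> A $$ (i, i) + - complex_of_real (cmod ?x) + (- complex_of_real (cmod ?x) + A $$ (j, j))"
      unfolding b1 b2 b3 by simp
    then show ?thesis by (simp add: less_eq_complex_def)
  qed
qed

lemma psd_mtrace:
  assumes P: "psd n A"
  shows "Im (mtrace A) = 0" and "0 \<le> Re (mtrace A)"
    and "\<And>l. l < n \<Longrightarrow> Re (A $$ (l, l)) \<le> Re (mtrace A)"
proof -
  have A: "A \<in> carrier_mat n n" using P unfolding psd_def by simp
  have d: "0 \<le> Re (A $$ (l, l))" "Im (A $$ (l, l)) = 0" if "l < n" for l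
    using psd_hermitian_and_bound(2)[OF P that that] by (auto simp: less_eq_complex_def)
  show "Im (mtrace A) = 0" using A d by (simp add: mtrace_def)
  show "0 \<le> Re (mtrace A)" using A d by (auto simp: mtrace_def intro!: sum_nonneg)
  fix l assume "l < n"
  then have "Re (A $$ (l, l)) \<le> (\<Sum>i<n. Re (A $$ (i, i)))"
    using d by (intro member_le_sum) auto
  then show "Re (A $$ (l, l)) \<le> Re (mtrace A)" using A by (simp add: mtrace_def)
qed

text \<open>Crude, but it suffices for two purposes: boundedness of the supremum in
  \<open>diamond_dist\<close> and positivity of weak effects.\<close>

lemma psd_entry_bound:
  assumes P: "psd n A" and i: "i < n" and j: "j < n"
  shows "cmod (A $$ (i, j)) \<le> Re (mtrace A)"
  using psd_hermitian_and_bound(3)[OF P i j] psd_mtrace(3)[OF P i] psd_mtrace(3)[OF P j] by linarith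

lemma block_carrier [simp]: "block n k b c \<rho> \<in> carrier_mat n n"
  by (simp add: block_def)

lemma ampliation_carrier [simp]: "ampliation n m k \<Lambda> \<rho> \<in> carrier_mat (m * k) (m * k)"
  by (simp add: ampliation_def)

lemma ampliation_dim [simp]:
  "dim_row (ampliation n m k \<Lambda> \<rho>) = m * k" "dim_col (ampliation n m k \<Lambda> \<rho>) = m * k"
  by (simp_all add: ampliation_def)

lemma mtrace_ampliation:
  assumes L: "quantum_channel n m \<Lambda>" and R: "\<rho> \<in> carrier_mat (n * k) (n * k)"
  shows "mtrace (ampliation n m k \<Lambda> \<rho>) = mtrace \<rho>"
proof -
  have C: "\<Lambda> (block n k b b \<rho>) \<in> carrier_mat m m" for b
    using L unfolding quantum_channel_def linear_map_def by simp
  have "mtrace (ampliation n m k \<Lambda> \<rho>) = (\<Sum>p<m * k. \<Lambda> (block n k (p mod k) (p mod k) \<rho>) $$ (p div k, p div k))"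
    by (simp add: mtrace_def ampliation_def)
  also have "\<dots> = (\<Sum>s<m. \<Sum>b<k. \<Lambda> (block n k b b \<rho>) $$ (s, s))"
    unfolding sum_lessThan_mult by (intro sum.cong refl) auto
  also have "\<dots> = (\<Sum>b<k. \<Sum>s<m. \<Lambda> (block n k b b \<rho>) $$ (s, s))" by (rule sum.swap)
  also have "\<dots> = (\<Sum>b<k. mtrace (\<Lambda> (block n k b b \<rho>)))"
    unfolding mtrace_def using C by (intro sum.cong refl) (metis carrier_matD(1))
  also have "\<dots> = (\<Sum>b<k. mtrace (block n k b b \<rho>))"
    using L by (simp add: quantum_channel_def)
  also have "\<dots> = (\<Sum>b<k. \<Sum>i<n. \<rho> $$ (i * k + b, i * k + b))"
    by (simp add: mtrace_def block_def)
  also have "\<dots> = (\<Sum>i<n. \<Sum>b<k. \<rho> $$ (i * k + b, i * k + b))" by (rule sum.swap)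
  also have "\<dots> = mtrace \<rho>" using R by (simp add: mtrace_def sum_lessThan_mult)
  finally show ?thesis .
qed

section \<open>Trace distance of states, and the supremum and infimum built from it\<close>

lemma trace_dist_nonneg: "0 \<le> trace_dist \<rho> \<sigma>"
  by (simp add: trace_dist_def trace_norm_nonneg)

lemma density_operator_cmod_le:
  assumes "density_operator n \<rho>" "i < n" "j < n"
  shows "cmod (\<rho> $$ (i, j)) \<le> 1"
  using psd_entry_bound[of n \<rho> i j] assms by (simp add: density_operator_def)

lemma density_operator_ampliation:
  assumes L: "quantum_channel n m \<Lambda>" and R: "density_operator (n * k) \<rho>"
  shows "density_operator (m * k) (ampliation n m k \<Lambda> \<rho>)"
proof -
  have "\<rho> \<in> carrier_mat (n * k) (n * k)" using R by (simp add: density_operator_def psd_def)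
  then show ?thesis
    using L R mtrace_ampliation[OF L, of \<rho> k]
    unfolding density_operator_def quantum_channel_def completely_positive_def by auto
qed

text \<open>Only a bound independent of the states matters: with it the supremum in
  \<open>diamond_dist\<close> really dominates each of its members. Entries of a difference of
  states have modulus at most 2.\<close>

lemma trace_dist_le:
  assumes R: "density_operator n \<rho>" and S: "density_operator n \<sigma>"
  shows "trace_dist \<rho> \<sigma> \<le> sqrt (real n * (4 * (real n)\<^sup>2))"
proof -
  have C: "\<rho> \<in> carrier_mat n n" "\<sigma> \<in> carrier_mat n n"
    using R S by (auto simp: density_operator_def psd_def)
  have e: "(cmod ((\<rho> - \<sigma>) $$ (i, j)))\<^sup>2 \<le> 4" if "i < n" "j < n" for i j
  proof -
    have "cmod (\<rho> $$ (i, j) - \<sigma> $$ (i, j)) \<le> 1 + 1"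
      using density_operator_cmod_le[OF R that] density_operator_cmod_le[OF S that]
      by (intro order_trans[OF norm_triangle_ineq4] add_mono)
    then have "(cmod (\<rho> $$ (i, j) - \<sigma> $$ (i, j)))\<^sup>2 \<le> (1 + 1)\<^sup>2" by (intro power_mono) auto
    then show ?thesis using C that by simp
  qed
  have "frob2 (\<rho> - \<sigma>) \<le> (\<Sum>i<n. \<Sum>j<n. 4)"
  proof -
    have "frob2 (\<rho> - \<sigma>) = (\<Sum>i<n. \<Sum>j<n. (cmod ((\<rho> - \<sigma>) $$ (i, j)))\<^sup>2)"
      using C by (simp add: frob2_def)
    also have "\<dots> \<le> (\<Sum>i<n. \<Sum>j<n. 4)" using e by (intro sum_mono) simp
    finally show ?thesis .
  qed
  then have "frob2 (\<rho> - \<sigma>) \<le> 4 * (real n)\<^sup>2" by (simp add: power2_eq_square algebra_simps)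
  then have "sqrt (real n * frob2 (\<rho> - \<sigma>)) \<le> sqrt (real n * (4 * (real n)\<^sup>2))"
    by (intro real_sqrt_le_mono mult_left_mono) auto
  moreover have "trace_norm (\<rho> - \<sigma>) \<le> sqrt (real n * frob2 (\<rho> - \<sigma>))"
    using C by (intro trace_norm_le[of _ n]) auto
  ultimately show ?thesis using trace_norm_nonneg[of "\<rho> - \<sigma>"] unfolding trace_dist_def by linarith
qed

lemma trace_dist_le_diamond_dist:
  assumes "quantum_channel n m \<Lambda>\<^sub>0" "quantum_channel n m \<Lambda>\<^sub>1" "density_operator (n * n) \<rho>"
  shows "trace_dist (ampliation n m n \<Lambda>\<^sub>0 \<rho>) (ampliation n m n \<Lambda>\<^sub>1 \<rho>) \<le> diamond_dist n m \<Lambda>\<^sub>0 \<Lambda>\<^sub>1"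
proof -
  have "bdd_above ((\<lambda>\<rho>. trace_dist (ampliation n m n \<Lambda>\<^sub>0 \<rho>) (ampliation n m n \<Lambda>\<^sub>1 \<rho>)) ` {\<rho>. density_operator (n * n) \<rho>})"
    unfolding bdd_above_def
    using assms trace_dist_le density_operator_ampliation by blast
  then show ?thesis unfolding diamond_dist_def using assms by (intro cSUP_upper) auto
qed

text \<open>The product state \<open>|v><v| \<otimes> |0><0|\<close>.\<close>

definition product_state :: "nat \<Rightarrow> nat \<Rightarrow> (nat \<Rightarrow> complex) \<Rightarrow> complex mat" where
  "product_state n k v = mat (n * k) (n * k)
     (\<lambda>(p, q). if p mod k = 0 \<and> q mod k = 0 then v (p div k) * cnj (v (q div k)) else 0)"

lemma density_operator_product_state:
  assumes v: "(\<Sum>i<n. (cmod (v i))\<^sup>2) = 1" and k: "k > 0"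
  shows "density_operator (n * k) (product_state n k v)"
proof -
  let ?g = "\<lambda>p. if p mod k = 0 then v (p div k) else 0"
  have e: "product_state n k v $$ (p, q) = ?g p * cnj (?g q)" if "p < n * k" "q < n * k" for p q
    using that by (simp add: product_state_def)
  have "0 \<le> (\<Sum>p<n*k. \<Sum>q<n*k. cnj (w p) * product_state n k v $$ (p, q) * w q)" for w :: "nat \<Rightarrow> complex"
  proof -
    have "(\<Sum>p<n*k. \<Sum>q<n*k. cnj (w p) * product_state n k v $$ (p, q) * w q)
        = (\<Sum>p<n*k. \<Sum>q<n*k. (cnj (w p) * ?g p) * (cnj (?g q) * w q))"
      by (intro sum.cong refl) (simp only: e lessThan_iff mult.assoc)
    also have "\<dots> = (\<Sum>p<n*k. cnj (w p) * ?g p) * (\<Sum>q<n*k. cnj (?g q) * w q)"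
      by (simp only: sum_product)
    also have "(\<Sum>q<n*k. cnj (?g q) * w q) = cnj (\<Sum>p<n*k. cnj (w p) * ?g p)"
      unfolding cnj_sum by (intro sum.cong refl) (simp only: complex_cnj_mult complex_cnj_cnj mult.commute)
    finally show ?thesis
      using conjugate_square_positive[of "\<Sum>p<n*k. cnj (w p) * ?g p"] by (simp only: conjugate_complex_def)
  qed
  then have "psd (n * k) (product_state n k v)"
    unfolding psd_iff by (simp add: product_state_def)
  moreover have "mtrace (product_state n k v) = 1"
  proof -
    have "mtrace (product_state n k v) = (\<Sum>p<n*k. ?g p * cnj (?g p))"
    proof -
      have "mtrace (product_state n k v) = (\<Sum>p<n*k. product_state n k v $$ (p, p))"
        by (simp add: mtrace_def product_state_def)
      also have "\<dots> = (\<Sum>p<n*k. ?g p * cnj (?g p))"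
        by (intro sum.cong refl) (simp only: e lessThan_iff)
      finally show ?thesis .
    qed
    also have "\<dots> = (\<Sum>i<n. \<Sum>b<k. if b = 0 then complex_of_real ((cmod (v i))\<^sup>2) else 0)"
      unfolding sum_lessThan_mult by (intro sum.cong refl) (auto simp: complex_norm_square simp flip: of_real_power)
    also have "\<dots> = complex_of_real (\<Sum>i<n. (cmod (v i))\<^sup>2)" using k by simp
    finally show ?thesis using v by simp
  qed
  ultimately show ?thesis by (simp add: density_operator_def)
qed

text \<open>\<open>n > 0\<close> supplies a density operator, so that the supremum is over a
  nonempty set.\<close>

lemma diamond_dist_nonneg:
  assumes "quantum_channel n m \<Lambda>\<^sub>0" "quantum_channel n m \<Lambda>\<^sub>1" "n > 0"
  shows "0 \<le> diamond_dist n m \<Lambda>\<^sub>0 \<Lambda>\<^sub>1"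
proof -
  have "(\<Sum>i<n. (cmod ((if i = 0 then 1 else 0) :: complex))\<^sup>2) = 1"
    using assms(3) by (simp add: if_distrib[of cmod] if_distrib[of "\<lambda>x. x\<^sup>2"] cong: if_cong)
  from density_operator_product_state[OF this assms(3)] show ?thesis
    using trace_dist_le_diamond_dist[OF assms(1,2)] trace_dist_nonneg order_trans by blast
qed

text \<open>All ratios are nonnegative, so the real infimum is over a set bounded below and each
  pair of channels bounds it from above.\<close>

lemma CDP_A_le:
  assumes "distinct_channels n m \<Lambda>\<^sub>0 \<Lambda>\<^sub>1" "n > 0"
  shows "CDP_A n k \<rho> \<le> trace_dist (ampliation n m k \<Lambda>\<^sub>0 \<rho>) (ampliation n m k \<Lambda>\<^sub>1 \<rho>) / diamond_dist n m \<Lambda>\<^sub>0 \<Lambda>\<^sub>1"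
proof -
  have "0 \<le> trace_dist (ampliation n m k \<Lambda>\<^sub>0 \<rho>) (ampliation n m k \<Lambda>\<^sub>1 \<rho>) / diamond_dist n m \<Lambda>\<^sub>0 \<Lambda>\<^sub>1"
    if "distinct_channels n m \<Lambda>\<^sub>0 \<Lambda>\<^sub>1" for m \<Lambda>\<^sub>0 \<Lambda>\<^sub>1
    using that diamond_dist_nonneg[of n m \<Lambda>\<^sub>0 \<Lambda>\<^sub>1] assms(2) trace_dist_nonneg
    by (auto simp: distinct_channels_def)
  then show ?thesis unfolding CDP_A_def using assms(1)
    by (intro cInf_lower) (blast, fastforce simp: bdd_below_def intro!: exI[of _ 0])
qed

section \<open>Binary measurement channels\<close>

definition hermitian_mat :: "nat \<Rightarrow> complex mat \<Rightarrow> bool" where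
  "hermitian_mat n F \<longleftrightarrow> F \<in> carrier_mat n n \<and> (\<forall>i<n. \<forall>j<n. F $$ (j, i) = cnj (F $$ (i, j)))"

text \<open>The operator \<open>Tr_A ((X (x) 1) rho)\<close> on B.\<close>

definition partial_tr :: "nat \<Rightarrow> nat \<Rightarrow> complex mat \<Rightarrow> complex mat \<Rightarrow> complex mat" where
  "partial_tr n k X \<rho> = mat k k (\<lambda>(b, c). mtrace (X * block n k b c \<rho>))"

text \<open>The operator \<open>(1 (x) <w|) rho (1 (x) |w>)\<close> on A; complete positivity of a
  measurement reduces to evaluating its effects on such compressions.\<close>

definition compress :: "nat \<Rightarrow> nat \<Rightarrow> (nat \<Rightarrow> complex) \<Rightarrow> complex mat \<Rightarrow> complex mat" where
  "compress n k w \<rho> = mat n n (\<lambda>(i, j). \<Sum>b<k. \<Sum>c<k. cnj (w b) * \<rho> $$ (i * k + b, j * k + c) * w c)"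

text \<open>Measures the effects \<open>1/2 + c F\<close> and \<open>1/2 - c F\<close> and stores
  the outcome in a diagonal qubit. In the difference of the channels for \<open>c\<close> and
  \<open>- c\<close> only the \<open>F\<close> part survives.\<close>

definition binary_channel :: "real \<Rightarrow> complex mat \<Rightarrow> complex mat \<Rightarrow> complex mat" where
  "binary_channel c F X = mat 2 2 (\<lambda>(i, j). if i = j
     then mtrace X / 2 + (if i = 0 then complex_of_real c else - complex_of_real c) * mtrace (F * X) else 0)"

lemma sum3_swap:
  "(\<Sum>i\<in>A. \<Sum>j\<in>B. \<Sum>b\<in>C. g i j b) = (\<Sum>b\<in>C. \<Sum>i\<in>A. \<Sum>j\<in>B. g i j b)"
proof -
  have "(\<Sum>i\<in>A. \<Sum>j\<in>B. \<Sum>b\<in>C. g i j b) = (\<Sum>i\<in>A. \<Sum>b\<in>C. \<Sum>j\<in>B. g i j b)"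
    by (rule sum.cong[OF refl], rule sum.swap)
  also have "\<dots> = (\<Sum>b\<in>C. \<Sum>i\<in>A. \<Sum>j\<in>B. g i j b)" by (rule sum.swap)
  finally show ?thesis .
qed

lemma sum4_swap:
  "(\<Sum>i\<in>A. \<Sum>j\<in>B. \<Sum>b\<in>C. \<Sum>c\<in>D. f i j b c) = (\<Sum>b\<in>C. \<Sum>c\<in>D. \<Sum>i\<in>A. \<Sum>j\<in>B. f i j b c)"
  unfolding sum3_swap[of "\<lambda>i j b. \<Sum>c\<in>D. f i j b c"] sum3_swap[of "\<lambda>i j c. f i j _ c"] ..

text \<open>The entry bound gives \<open>|Tr (F R)| <= (sum of |F_ij|) * Tr R\<close>, and
  \<open>Tr (F R)\<close> is real because both factors are Hermitian.\<close>

lemma effect_nonneg: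
  assumes P: "psd n R" and F: "hermitian_mat n F"
    and c: "\<bar>c\<bar> * (\<Sum>i<n. \<Sum>j<n. cmod (F $$ (i, j))) \<le> 1 / 2"
  shows "0 \<le> mtrace R / 2 + complex_of_real c * mtrace (F * R)"
proof -
  let ?K = "\<Sum>i<n. \<Sum>j<n. cmod (F $$ (i, j))"
  have C: "R \<in> carrier_mat n n" "F \<in> carrier_mat n n"
    using P F by (auto simp: psd_def hermitian_mat_def)
  have t: "mtrace (F * R) = (\<Sum>i<n. \<Sum>j<n. F $$ (i, j) * R $$ (j, i))" using C by (simp add: mtrace_mult)
  have "cnj (mtrace (F * R)) = (\<Sum>i<n. \<Sum>j<n. F $$ (j, i) * R $$ (i, j))"
    unfolding t cnj_sum complex_cnj_mult
  proof (intro sum.cong refl)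
    fix i j assume "i \<in> {..<n}" "j \<in> {..<n}"
    then have "i < n" "j < n" by auto
    then have "F $$ (j, i) = cnj (F $$ (i, j))" "R $$ (j, i) = cnj (R $$ (i, j))"
      using F psd_hermitian_and_bound(1)[OF P, of i j] unfolding hermitian_mat_def by blast+
    then show "cnj (F $$ (i, j)) * cnj (R $$ (j, i)) = F $$ (j, i) * R $$ (i, j)"
      by (simp only: complex_cnj_cnj)
  qed
  also have "\<dots> = mtrace (F * R)" unfolding t by (rule sum.swap)
  finally have real: "mtrace (F * R) = complex_of_real (Re (mtrace (F * R)))"
    by (simp add: complex_eq_iff)
  have "cmod (mtrace (F * R)) \<le> (\<Sum>i<n. \<Sum>j<n. cmod (F $$ (i, j)) * Re (mtrace R))"
    unfolding t
    by (intro sum_norm_le) (auto simp: norm_mult intro!: mult_left_mono psd_entry_bound[OF P])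
  also have "\<dots> = ?K * Re (mtrace R)" by (simp add: sum_distrib_right)
  finally have "cmod (mtrace (F * R)) \<le> ?K * Re (mtrace R)" .
  then have "\<bar>c\<bar> * \<bar>Re (mtrace (F * R))\<bar> \<le> \<bar>c\<bar> * (?K * Re (mtrace R))"
    using abs_Re_le_cmod[of "mtrace (F * R)"] by (intro mult_left_mono) auto
  also have "\<dots> \<le> 1 / 2 * Re (mtrace R)"
    using mult_right_mono[OF c psd_mtrace(2)[OF P]] by (simp add: mult.assoc)
  finally have "\<bar>c * Re (mtrace (F * R))\<bar> \<le> Re (mtrace R) / 2" by (simp add: abs_mult)
  then have le: "0 \<le> Re (mtrace R) / 2 + c * Re (mtrace (F * R))" by linarith
  have "mtrace R = complex_of_real (Re (mtrace R))"
    using psd_mtrace(1)[OF P] by (simp add: complex_eq_iff)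
  then have "mtrace R / 2 + complex_of_real c * mtrace (F * R)
      = complex_of_real (Re (mtrace R) / 2 + c * Re (mtrace (F * R)))"
    using real by (metis of_real_add of_real_divide of_real_mult of_real_numeral)
  then show ?thesis using le by (simp only: less_eq_complex_def) simp
qed

lemma mtrace_mult_block:
  assumes X: "X \<in> carrier_mat n n"
  shows "mtrace (X * block n k b c \<rho>) = (\<Sum>i<n. \<Sum>j<n. X $$ (i, j) * \<rho> $$ (j * k + b, i * k + c))"
  unfolding mtrace_mult[OF X block_carrier] by (intro sum.cong refl) (simp add: block_def)

lemma partial_tr_index:
  assumes X: "X \<in> carrier_mat n n" and bc: "b < k" "c < k"
  shows "partial_tr n k X \<rho> $$ (b, c) = (\<Sum>i<n. \<Sum>j<n. X $$ (i, j) * \<rho> $$ (j * k + b, i * k + c))"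
  using bc by (simp add: partial_tr_def mtrace_mult_block[OF X])

text \<open>The form of the compression at \<open>u\<close> is the form of \<open>rho\<close> at
  \<open>u (x) w\<close>.\<close>

lemma psd_compress:
  assumes "psd (n * k) \<rho>"
  shows "psd n (compress n k w \<rho>)"
proof -
  have "0 \<le> (\<Sum>i<n. \<Sum>j<n. cnj (u i) * compress n k w \<rho> $$ (i, j) * u j)" for u
  proof -
    let ?x = "\<lambda>p. u (p div k) * w (p mod k)"
    have "(\<Sum>p<n*k. \<Sum>q<n*k. cnj (?x p) * \<rho> $$ (p, q) * ?x q)
        = (\<Sum>i<n. \<Sum>b<k. \<Sum>j<n. \<Sum>c<k. cnj (u i * w b) * \<rho> $$ (i * k + b, j * k + c) * (u j * w c))"
      unfolding sum_lessThan_mult by (intro sum.cong refl) auto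
    also have "\<dots> = (\<Sum>i<n. \<Sum>j<n. \<Sum>b<k. \<Sum>c<k. cnj (u i * w b) * \<rho> $$ (i * k + b, j * k + c) * (u j * w c))"
      by (rule sum.cong[OF refl], rule sum.swap)
    also have "\<dots> = (\<Sum>i<n. \<Sum>j<n. cnj (u i) * compress n k w \<rho> $$ (i, j) * u j)"
      by (intro sum.cong refl) (simp add: compress_def sum_distrib_left sum_distrib_right mult_ac)
    finally have eq: "(\<Sum>p<n*k. \<Sum>q<n*k. cnj (?x p) * \<rho> $$ (p, q) * ?x q)
        = (\<Sum>i<n. \<Sum>j<n. cnj (u i) * compress n k w \<rho> $$ (i, j) * u j)" .
    have "0 \<le> (\<Sum>p<n*k. \<Sum>q<n*k. cnj (?x p) * \<rho> $$ (p, q) * ?x q)"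
      using assms unfolding psd_iff by (elim conjE allE[of _ ?x])
    then show ?thesis unfolding eq .
  qed
  then show ?thesis unfolding psd_iff by (simp add: compress_def)
qed

lemma mtrace_compress:
  assumes X: "X \<in> carrier_mat n n"
  shows "mtrace (X * compress n k w \<rho>) = (\<Sum>b<k. \<Sum>c<k. cnj (w b) * mtrace (X * block n k b c \<rho>) * w c)"
proof -
  have "mtrace (X * compress n k w \<rho>)
      = (\<Sum>i<n. \<Sum>j<n. X $$ (i, j) * compress n k w \<rho> $$ (j, i))"
    using X by (intro mtrace_mult) (auto simp: compress_def)
  also have "\<dots> = (\<Sum>i<n. \<Sum>j<n. \<Sum>b<k. \<Sum>c<k. cnj (w b) * (X $$ (i, j) * \<rho> $$ (j * k + b, i * k + c)) * w c)"
    by (intro sum.cong refl) (simp add: compress_def sum_distrib_left mult_ac)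
  also have "\<dots> = (\<Sum>b<k. \<Sum>c<k. \<Sum>i<n. \<Sum>j<n. cnj (w b) * (X $$ (i, j) * \<rho> $$ (j * k + b, i * k + c)) * w c)"
    by (rule sum4_swap)
  also have "\<dots> = (\<Sum>b<k. \<Sum>c<k. cnj (w b) * mtrace (X * block n k b c \<rho>) * w c)"
  proof (intro sum.cong refl)
    fix b c
    show "(\<Sum>i<n. \<Sum>j<n. cnj (w b) * (X $$ (i, j) * \<rho> $$ (j * k + b, i * k + c)) * w c)
        = cnj (w b) * mtrace (X * block n k b c \<rho>) * w c"
      by (simp add: mtrace_mult_block[OF X] sum_distrib_left sum_distrib_right)
  qed
  finally show ?thesis .
qed

lemma binary_channel_ampliation_index:
  assumes "s < 2" "t < 2" "b < k" "c < k"
  shows "ampliation n 2 k (binary_channel a F) \<rho> $$ (s * k + b, t * k + c) =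
    (if s = t then mtrace (block n k b c \<rho>) / 2
       + (if s = 0 then complex_of_real a else - complex_of_real a) * mtrace (F * block n k b c \<rho>) else 0)"
  using assms pair_index_less[of s 2 b k] pair_index_less[of t 2 c k]
  by (simp add: ampliation_def binary_channel_def)

text \<open>For complete positivity: the ampliated output is block diagonal in the outcome
  \<open>s\<close>, so its form splits into one term per outcome, each an effect evaluated on a
  compression of \<open>rho\<close>.\<close>

lemma quantum_channel_binary_channel:
  assumes F: "hermitian_mat n F" and a: "\<bar>a\<bar> * (\<Sum>i<n. \<Sum>j<n. cmod (F $$ (i, j))) \<le> 1 / 2"
  shows "quantum_channel n 2 (binary_channel a F)"
proof -
  have FC: "F \<in> carrier_mat n n" using F by (simp add: hermitian_mat_def)
  have "linear_map n 2 (binary_channel a F)"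
    unfolding linear_map_def
  proof (intro conjI ballI allI)
    fix X Y :: "complex mat" and c :: complex
    assume X: "X \<in> carrier_mat n n"
    show "binary_channel a F X \<in> carrier_mat 2 2" by (simp add: binary_channel_def)
    have "mtrace (c \<cdot>\<^sub>m X) = c * mtrace X" "mtrace (F * (c \<cdot>\<^sub>m X)) = c * mtrace (F * X)"
      using X FC by (auto simp: mtrace_def sum_distrib_left)
    then show "binary_channel a F (c \<cdot>\<^sub>m X) = c \<cdot>\<^sub>m binary_channel a F X"
      by (intro eq_matI) (auto simp: binary_channel_def algebra_simps)
    assume Y: "Y \<in> carrier_mat n n"
    have "mtrace (X + Y) = mtrace X + mtrace Y" "mtrace (F * (X + Y)) = mtrace (F * X) + mtrace (F * Y)"
      using X Y FC by (auto simp: mtrace_def sum.distrib mult_add_distrib_mat[of F n n X n Y])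
    then show "binary_channel a F (X + Y) = binary_channel a F X + binary_channel a F Y"
      by (intro eq_matI) (auto simp: binary_channel_def algebra_simps add_divide_distrib)
  qed
  moreover have "completely_positive n 2 (binary_channel a F)"
    unfolding completely_positive_def
  proof (intro allI impI)
    fix k \<rho> assume P: "psd (n * k) \<rho>"
    let ?A = "ampliation n 2 k (binary_channel a F) \<rho>"
    have "0 \<le> (\<Sum>p<2*k. \<Sum>q<2*k. cnj (v p) * ?A $$ (p, q) * v q)" for v :: "nat \<Rightarrow> complex"
    proof -
      let ?w = "\<lambda>s b. v (s * k + b)"
      let ?a = "\<lambda>s. if s = 0 then a else - a :: real"
      have ca: "complex_of_real (?a s) = (if s = 0 then complex_of_real a else - complex_of_real a)" for s :: nat
        by simp
      let ?B = "\<lambda>s b c. mtrace (block n k b c \<rho>) / 2 + complex_of_real (?a s) * mtrace (F * block n k b c \<rho>)"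
      have "(\<Sum>p<2*k. \<Sum>q<2*k. cnj (v p) * ?A $$ (p, q) * v q)
          = (\<Sum>s<2. \<Sum>b<k. \<Sum>t<2. \<Sum>c<k. cnj (?w s b) * ?A $$ (s * k + b, t * k + c) * ?w t c)"
        unfolding sum_lessThan_mult ..
      also have "\<dots> = (\<Sum>s<2. \<Sum>b<k. \<Sum>t<2. if s = t then (\<Sum>c<k. cnj (?w s b) * ?B s b c * ?w s c) else 0)"
        by (intro sum.cong refl) (auto simp: binary_channel_ampliation_index)
      also have "\<dots> = (\<Sum>s<2. \<Sum>b<k. \<Sum>c<k. cnj (?w s b) * ?B s b c * ?w s c)"
        by (rule sum.cong[OF refl], rule sum.cong[OF refl]) simp
      also have "\<dots> = (\<Sum>s<2. mtrace (compress n k (?w s) \<rho>) / 2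
          + complex_of_real (?a s) * mtrace (F * compress n k (?w s) \<rho>))"
      proof (rule sum.cong[OF refl])
        fix s
        have one: "mtrace (compress n k (?w s) \<rho>) = (\<Sum>b<k. \<Sum>c<k. cnj (?w s b) * mtrace (block n k b c \<rho>) * ?w s c)"
          using mtrace_compress[OF one_carrier_mat, of n k "?w s" \<rho>] left_mult_one_mat[OF block_carrier]
            left_mult_one_mat[of "compress n k (?w s) \<rho>" n n]
          by (simp add: compress_def)
        show "(\<Sum>b<k. \<Sum>c<k. cnj (?w s b) * ?B s b c * ?w s c) = mtrace (compress n k (?w s) \<rho>) / 2
          + complex_of_real (?a s) * mtrace (F * compress n k (?w s) \<rho>)"
          unfolding one mtrace_compress[OF FC] sum_distrib_left sum_divide_distrib sum.distrib[symmetric]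
          by (intro sum.cong refl) (simp only: distrib_left distrib_right times_divide_eq_left times_divide_eq_right mult_ac)
      qed
      also have "0 \<le> \<dots>"
      proof (rule sum_nonneg)
        fix s :: nat
        show "0 \<le> mtrace (compress n k (?w s) \<rho>) / 2
          + complex_of_real (?a s) * mtrace (F * compress n k (?w s) \<rho>)"
          using a by (intro effect_nonneg[OF psd_compress[OF P] F]) auto
      qed
      finally show ?thesis .
    qed
    then show "psd (2 * k) ?A" unfolding psd_iff by simp
  qed
  moreover have "mtrace (binary_channel a F X) = mtrace X" for X
  proof -
    have "{..<2} = {0, 1 :: nat}" by auto
    then show ?thesis by (simp add: mtrace_def[of "binary_channel a F X"]) (simp add: binary_channel_def)
  qed
  ultimately show ?thesis unfolding quantum_channel_def by blast
qed

definition quad_form :: "nat \<Rightarrow> complex mat \<Rightarrow> (nat \<Rightarrow> complex) \<Rightarrow> complex" where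
  "quad_form n F v = (\<Sum>i<n. \<Sum>j<n. cnj (v i) * F $$ (i, j) * v j)"

lemma ampliation_binary_channel_diff:
  "ampliation n 2 k (binary_channel a F) \<rho> - ampliation n 2 k (binary_channel (- a) F) \<rho>
   = mat (2 * k) (2 * k) (\<lambda>(p, q). if p div k = q div k
       then complex_of_real (if p div k = 0 then 2 * a else - 2 * a) * partial_tr n k F \<rho> $$ (p mod k, q mod k) else 0)"
proof (intro eq_matI, goal_cases)
  case (1 p q)
  then have pq: "p < 2 * k" "q < 2 * k" by auto
  then have k: "k > 0" by (cases k) auto
  have d: "p div k < 2" "q div k < 2" using pq by (simp_all add: less_mult_imp_div_less)
  show ?case using pq k d by (simp add: ampliation_def binary_channel_def partial_tr_def algebra_simps)
qed auto

text \<open>The difference is \<open>2 a ?T\<close> on outcome 0 and its negative on outcome 1,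
  hence has squared norm \<open>8 a^2 |?T|_2^2\<close> in dimension \<open>2 k\<close>;
  Cauchy-Schwarz on the singular values does the rest.\<close>

lemma trace_dist_binary_channel:
  "trace_dist (ampliation n 2 k (binary_channel a F) \<rho>) (ampliation n 2 k (binary_channel (- a) F) \<rho>)
   \<le> 2 * \<bar>a\<bar> * sqrt (real k * frob2 (partial_tr n k F \<rho>))"
proof -
  let ?T = "partial_tr n k F \<rho>"
  define D where "D = ampliation n 2 k (binary_channel a F) \<rho> - ampliation n 2 k (binary_channel (- a) F) \<rho>"
  have DC: "D \<in> carrier_mat (2 * k) (2 * k)" unfolding D_def by (intro carrier_matI) auto
  have "frob2 D = (\<Sum>s<2. \<Sum>b<k. \<Sum>t<2. \<Sum>c<k. (cmod (D $$ (s * k + b, t * k + c)))\<^sup>2)"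
    using DC by (simp add: frob2_def sum_lessThan_mult)
  also have "\<dots> = (\<Sum>s<2. \<Sum>b<k. \<Sum>t<2. if (s::nat) = t then (\<Sum>c<k. 4 * a\<^sup>2 * (cmod (?T $$ (b, c)))\<^sup>2) else 0)"
  proof (intro sum.cong refl, goal_cases)
    case (1 s b t)
    then have "s < 2" "b < k" "t < 2" by auto
    then show ?case
      using pair_index_less[of s 2 b k] pair_index_less[of t 2 _ k]
      by (auto simp: D_def ampliation_binary_channel_diff norm_mult power_mult_distrib intro!: sum.cong)
  qed
  also have "\<dots> = 8 * a\<^sup>2 * frob2 ?T"
    by (simp add: frob2_def partial_tr_def sum_distrib_left mult.assoc)
  finally have f: "frob2 D = 8 * a\<^sup>2 * frob2 ?T" .
  have "trace_norm D \<le> sqrt (real (2 * k) * (8 * a\<^sup>2 * frob2 ?T))"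
    using trace_norm_le[OF DC] f by simp
  also have "\<dots> = sqrt ((4 * \<bar>a\<bar>)\<^sup>2 * (real k * frob2 ?T))"
    by (simp add: power_mult_distrib mult_ac)
  also have "\<dots> = 4 * \<bar>a\<bar> * sqrt (real k * frob2 ?T)"
    by (simp add: real_sqrt_mult)
  finally show ?thesis by (simp add: trace_dist_def D_def)
qed

lemma partial_tr_product_state:
  assumes F: "F \<in> carrier_mat n n" and bc: "b < k" "c < k"
  shows "partial_tr n k F (product_state n k v) $$ (b, c) = (if b = 0 \<and> c = 0 then quad_form n F v else 0)"
proof -
  have "partial_tr n k F (product_state n k v) $$ (b, c)
      = (\<Sum>i<n. \<Sum>j<n. F $$ (i, j) * product_state n k v $$ (j * k + b, i * k + c))"
    using F bc by (rule partial_tr_index)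
  also have "\<dots> = (\<Sum>i<n. \<Sum>j<n. if b = 0 \<and> c = 0 then cnj (v i) * F $$ (i, j) * v j else 0)"
    using bc pair_index_less[of _ n b k] pair_index_less[of _ n c k]
    by (intro sum.cong refl) (auto simp: product_state_def)
  also have "\<dots> = (if b = 0 \<and> c = 0 then quad_form n F v else 0)" by (simp add: quad_form_def)
  finally show ?thesis .
qed

text \<open>The ancilla \<open>|0><0|\<close> makes the difference diagonal, with entry
  \<open>2 a y\<close> for one outcome, \<open>- 2 a y\<close> for the other and zeros
  elsewhere.\<close>

lemma trace_dist_binary_channel_product_state:
  assumes F: "F \<in> carrier_mat n n" and k: "k > 0" and y: "quad_form n F v = complex_of_real y"
  shows "trace_dist (ampliation n 2 k (binary_channel a F) (product_state n k v))
           (ampliation n 2 k (binary_channel (- a) F) (product_state n k v)) = 2 * \<bar>a\<bar> * \<bar>y\<bar>"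
proof -
  let ?f = "\<lambda>p. if p mod k = 0 then (if p div k = 0 then 2 * a else - 2 * a) * y else 0"
  have "trace_norm (ampliation n 2 k (binary_channel a F) (product_state n k v)
           - ampliation n 2 k (binary_channel (- a) F) (product_state n k v)) = (\<Sum>p<2 * k. \<bar>?f p\<bar>)"
  proof (rule trace_norm_real_diagonal, unfold ampliation_binary_channel_diff, intro eq_matI, goal_cases)
    case (1 p q)
    then have pq: "p < 2 * k" "q < 2 * k" by auto
    have eq: "p = q" if "p div k = q div k" "k dvd p" "k dvd q" using that by (metis dvd_div_mult_self)
    show ?case using pq k eq by (auto simp: partial_tr_product_state[OF F] y)
  qed auto
  also have "\<dots> = (\<Sum>s<(2::nat). \<Sum>b<k. if b = 0 then 2 * \<bar>a\<bar> * \<bar>y\<bar> else 0)"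
    unfolding sum_lessThan_mult by (intro sum.cong refl) (auto simp: abs_mult)
  also have "\<dots> = 4 * \<bar>a\<bar> * \<bar>y\<bar>" using k by simp
  finally show ?thesis by (simp add: trace_dist_def)
qed

lemma CDP_A_le_partial_tr:
  assumes F: "hermitian_mat n F" and n: "n > 0" and v: "(\<Sum>i<n. (cmod (v i))\<^sup>2) = 1"
    and y: "quad_form n F v = complex_of_real y" "y \<noteq> 0"
  shows "CDP_A n k \<rho> \<le> sqrt (real k * frob2 (partial_tr n k F \<rho>)) / \<bar>y\<bar>"
proof -
  have FC: "F \<in> carrier_mat n n" using F by (simp add: hermitian_mat_def)
  define K where "K = (\<Sum>i<n. \<Sum>j<n. cmod (F $$ (i, j)))"
  have K: "K \<ge> 0" unfolding K_def by (intro sum_nonneg) auto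
  \<comment> \<open>\<open>K + 1\<close> keeps the denominator positive even for
    \<open>K = 0\<close>; the factor \<open>2 a\<close> cancels in the final quotient.\<close>
  define a where "a = 1 / (2 * (K + 1))"
  have a: "a > 0" using K by (simp add: a_def)
  have "\<bar>a\<bar> * K \<le> 1 / 2" using K by (simp add: a_def field_simps)
  then have q: "quantum_channel n 2 (binary_channel a F)" "quantum_channel n 2 (binary_channel (- a) F)"
    using F by (auto simp: K_def intro!: quantum_channel_binary_channel)
  \<comment> \<open>The operator \<open>|v><v|\<close> witnesses that the channels are distinct: the
    outputs differ by \<open>2 a y\<close> in entry \<open>(0, 0)\<close>.\<close>
  let ?X = "mat n n (\<lambda>(i, j). v i * cnj (v j))"
  have X: "mtrace (F * ?X) = complex_of_real y"
    unfolding y(1)[symmetric] quad_form_def by (subst mtrace_mult[OF FC]) (auto simp: mult_ac intro!: sum.cong)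
  have "binary_channel a F ?X $$ (0, 0) \<noteq> binary_channel (- a) F ?X $$ (0, 0)"
    using a y by (simp add: binary_channel_def X)
  then have "binary_channel a F ?X \<noteq> binary_channel (- a) F ?X" by metis
  then have dist: "distinct_channels n 2 (binary_channel a F) (binary_channel (- a) F)"
    using q unfolding distinct_channels_def by (meson mat_carrier)
  have dd: "2 * a * \<bar>y\<bar> \<le> diamond_dist n 2 (binary_channel a F) (binary_channel (- a) F)"
    using trace_dist_le_diamond_dist[OF q density_operator_product_state[OF v n]]
      trace_dist_binary_channel_product_state[OF FC n y(1), of a] a by simp
  have "CDP_A n k \<rho> \<le> trace_dist (ampliation n 2 k (binary_channel a F) \<rho>) (ampliation n 2 k (binary_channel (- a) F) \<rho>)
      / diamond_dist n 2 (binary_channel a F) (binary_channel (- a) F)"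
    by (rule CDP_A_le[OF dist n])
  also have "\<dots> \<le> (2 * a * sqrt (real k * frob2 (partial_tr n k F \<rho>))) / (2 * a * \<bar>y\<bar>)"
    using trace_dist_binary_channel[of n k a F \<rho>] a y dd trace_dist_nonneg
    by (intro frac_le) (auto simp: frob2_nonneg)
  also have "\<dots> = sqrt (real k * frob2 (partial_tr n k F \<rho>)) / \<bar>y\<bar>" using a by simp
  finally show ?thesis .
qed

section \<open>Averaging over traceless observables\<close>

lemma partial_tr_carrier [simp]: "partial_tr n k X \<rho> \<in> carrier_mat k k"
  by (simp add: partial_tr_def)

lemma partial_tr_dim [simp]:
  "dim_row (partial_tr n k X \<rho>) = k" "dim_col (partial_tr n k X \<rho>) = k"
  by (simp_all add: partial_tr_def)

lemma partial_tr_add: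
  assumes "X \<in> carrier_mat n n" "Y \<in> carrier_mat n n"
  shows "partial_tr n k (X + Y) \<rho> = partial_tr n k X \<rho> + partial_tr n k Y \<rho>"
  using assms
  by (intro eq_matI) (auto simp: partial_tr_index[of _ n] sum.distrib algebra_simps)

lemma partial_tr_smult:
  assumes "X \<in> carrier_mat n n"
  shows "partial_tr n k (a \<cdot>\<^sub>m X) \<rho> = a \<cdot>\<^sub>m partial_tr n k X \<rho>"
  using assms
  by (intro eq_matI) (auto simp: partial_tr_index[of _ n] sum_distrib_left mult_ac)

text \<open>Holds because \<open>rho\<close> is Hermitian. It gives \<open>X\<close> and its adjoint
  images of equal norm, which \<open>hermitian_part\<close> relies on.\<close>

lemma partial_tr_adjoint:
  assumes P: "psd (n * k) \<rho>" and X: "X \<in> carrier_mat n n"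
  shows "partial_tr n k (mat_adjoint X) \<rho> = mat_adjoint (partial_tr n k X \<rho>)"
proof (intro eq_matI, goal_cases)
  case (1 b c)
  then have bc: "b < k" "c < k" by auto
  have "partial_tr n k (mat_adjoint X) \<rho> $$ (b, c)
      = (\<Sum>i<n. \<Sum>j<n. mat_adjoint X $$ (i, j) * \<rho> $$ (j * k + b, i * k + c))"
    using X bc by (intro partial_tr_index) auto
  also have "\<dots> = (\<Sum>i<n. \<Sum>j<n. cnj (X $$ (j, i) * \<rho> $$ (i * k + c, j * k + b)))"
  proof (intro sum.cong refl)
    fix i j assume "i \<in> {..<n}" "j \<in> {..<n}"
    then have ij: "i < n" "j < n" by auto
    have "\<rho> $$ (j * k + b, i * k + c) = cnj (\<rho> $$ (i * k + c, j * k + b))"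
      using psd_hermitian_and_bound(1)[OF P, of "i * k + c" "j * k + b"] ij bc pair_index_less by blast
    then show "mat_adjoint X $$ (i, j) * \<rho> $$ (j * k + b, i * k + c) = cnj (X $$ (j, i) * \<rho> $$ (i * k + c, j * k + b))"
      using X ij by simp
  qed
  also have "\<dots> = (\<Sum>j<n. \<Sum>i<n. cnj (X $$ (j, i) * \<rho> $$ (i * k + c, j * k + b)))" by (rule sum.swap)
  also have "\<dots> = cnj (partial_tr n k X \<rho> $$ (c, b))"
    using X bc by (simp add: partial_tr_index)
  finally show ?case using bc by simp
qed auto

lemma frob2_carrier:
  "A \<in> carrier_mat n m \<Longrightarrow> frob2 A = (\<Sum>i<n. \<Sum>j<m. (cmod (A $$ (i, j)))\<^sup>2)"
  by (simp add: frob2_def)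

lemma frob2_smult: "frob2 (a \<cdot>\<^sub>m A) = (cmod a)\<^sup>2 * frob2 A"
  by (simp add: frob2_def norm_mult power_mult_distrib sum_distrib_left)

lemma cmod_parallelogram:
  "(cmod (x + y))\<^sup>2 + (cmod (x - y))\<^sup>2 = 2 * (cmod x)\<^sup>2 + 2 * (cmod y)\<^sup>2"
  unfolding cmod_power2 by (simp add: power2_eq_square algebra_simps)

lemma frob2_parallelogram:
  assumes "A \<in> carrier_mat n m" "B \<in> carrier_mat n m"
  shows "frob2 (A + B) + frob2 (A + (- 1) \<cdot>\<^sub>m B) = 2 * frob2 A + 2 * frob2 B"
proof -
  have "frob2 (A + B) + frob2 (A + (- 1) \<cdot>\<^sub>m B)
      = (\<Sum>i<n. \<Sum>j<m. (cmod (A $$ (i, j) + B $$ (i, j)))\<^sup>2 + (cmod (A $$ (i, j) - B $$ (i, j)))\<^sup>2)"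
    using assms by (simp add: frob2_def sum.distrib)
  also have "\<dots> = 2 * frob2 A + 2 * frob2 B"
    using assms by (simp add: cmod_parallelogram frob2_def sum.distrib sum_distrib_left)
  finally show ?thesis .
qed

lemma mtrace_add: "A \<in> carrier_mat n n \<Longrightarrow> B \<in> carrier_mat n n \<Longrightarrow> mtrace (A + B) = mtrace A + mtrace B"
  by (simp add: mtrace_def sum.distrib)

lemma mtrace_smult: "A \<in> carrier_mat n n \<Longrightarrow> mtrace (a \<cdot>\<^sub>m A) = a * mtrace A"
  by (simp add: mtrace_def sum_distrib_left)

lemma mtrace_adjoint: "A \<in> carrier_mat n n \<Longrightarrow> mtrace (mat_adjoint A) = cnj (mtrace A)"
  by (simp add: mtrace_def)

text \<open>Both \<open>X + X\<^sup>*\<close> and \<open>\<i> (X - X\<^sup>*)\<close> are Hermitian, and by the parallelogram law the bound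
  cannot fail for both of them.\<close>

lemma hermitian_part:
  assumes P: "psd (n * k) \<rho>" and X: "X \<in> carrier_mat n n" "0 < frob2 X"
    and le: "frob2 (partial_tr n k X \<rho>) \<le> \<kappa> * frob2 X"
  obtains H where "hermitian_mat n H" "0 < frob2 H"
    "frob2 (partial_tr n k H \<rho>) \<le> \<kappa> * frob2 H" "mtrace X = 0 \<Longrightarrow> mtrace H = 0"
proof -
  let ?T = "\<lambda>X. partial_tr n k X \<rho>"
  let ?Y = "mat_adjoint X"
  have Y: "?Y \<in> carrier_mat n n" using X by simp
  define A where "A = X + ?Y"
  define D where "D = X + (- 1) \<cdot>\<^sub>m ?Y"
  define B where "B = \<i> \<cdot>\<^sub>m D"
  have C: "A \<in> carrier_mat n n" "D \<in> carrier_mat n n" "B \<in> carrier_mat n n"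
    using X Y by (auto simp: A_def D_def B_def)
  have h: "hermitian_mat n A" "hermitian_mat n B"
    using X C unfolding hermitian_mat_def by (auto simp: A_def B_def D_def algebra_simps)
  have t: "mtrace A = 0" "mtrace B = 0" if "mtrace X = 0"
    using that X Y C unfolding A_def B_def mtrace_smult[OF C(2)]
    by (auto simp: D_def mtrace_add[of _ n] mtrace_smult[of _ n] mtrace_adjoint[of _ n])
  have f: "frob2 A + frob2 B = 4 * frob2 X"
    using frob2_parallelogram[OF X(1) Y] by (simp add: A_def B_def D_def frob2_smult frob2_adjoint)
  have TA: "?T A = ?T X + ?T ?Y" using X Y by (simp add: A_def partial_tr_add)
  have TD: "?T D = ?T X + (- 1) \<cdot>\<^sub>m ?T ?Y"
    using X Y by (simp add: D_def partial_tr_add partial_tr_smult)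
  have TB: "frob2 (?T B) = frob2 (?T D)"
    using C by (simp add: B_def partial_tr_smult frob2_smult)
  have "frob2 (?T A) + frob2 (?T B) = 4 * frob2 (?T X)"
    using frob2_parallelogram[OF partial_tr_carrier partial_tr_carrier, of n k X \<rho> n ?Y \<rho>]
    by (simp add: TA TB TD partial_tr_adjoint[OF P X(1)] frob2_adjoint)
  then have g: "frob2 (?T A) + frob2 (?T B) \<le> \<kappa> * frob2 A + \<kappa> * frob2 B"
    using le f by (simp add: distrib_left[symmetric])
  note nn = frob2_nonneg[of A] frob2_nonneg[of B] frob2_nonneg[of "?T A"] frob2_nonneg[of "?T B"]
  \<comment> \<open>A zero component is useless as an observable. If \<open>A\<close> vanishes,
    \<open>B\<close> carries the whole norm; if the bound fails for \<open>A\<close>, it holds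
    strictly for \<open>B\<close>, which is then nonzero.\<close>
  consider "frob2 A > 0" "frob2 (?T A) \<le> \<kappa> * frob2 A" | "frob2 B > 0" "frob2 (?T B) \<le> \<kappa> * frob2 B"
  proof (cases "frob2 A = 0")
    case True
    then have "frob2 B > 0" using f X by simp
    moreover have "frob2 (?T B) \<le> \<kappa> * frob2 B" using g nn True by simp
    ultimately show ?thesis using that by blast
  next
    case A0: False
    show ?thesis
    proof (cases "frob2 (?T A) \<le> \<kappa> * frob2 A")
      case True
      then show ?thesis using that(1) A0 nn by linarith
    next
      case False
      then have lt: "frob2 (?T B) < \<kappa> * frob2 B" using g by linarith
      then have "frob2 B \<noteq> 0" using nn by auto
      then show ?thesis using that(2) lt nn by linarith
    qed
  qed
  then show ?thesis using that h t by cases blast+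
qed

text \<open>Expand each square; the cross terms factor into the squared modulus of the sum. Applied
  entrywise, it trades the differences \<open>E_aa - E_bb\<close> for the diagonal units and the
  identity.\<close>

lemma sum_sum_cmod_diff:
  fixes x :: "nat \<Rightarrow> complex"
  shows "(\<Sum>a<n. \<Sum>b<n. (cmod (x a - x b))\<^sup>2) = 2 * real n * (\<Sum>a<n. (cmod (x a))\<^sup>2) - 2 * (cmod (\<Sum>a<n. x a))\<^sup>2"
proof -
  have e: "(cmod (x a - x b))\<^sup>2 = (cmod (x a))\<^sup>2 + (cmod (x b))\<^sup>2 - 2 * (Re (x a) * Re (x b) + Im (x a) * Im (x b))" for a b
    unfolding cmod_power2 by (simp add: power2_eq_square algebra_simps)
  have "(\<Sum>a<n. \<Sum>b<n. Re (x a) * Re (x b) + Im (x a) * Im (x b)) = (cmod (\<Sum>a<n. x a))\<^sup>2"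
    unfolding cmod_power2 by (simp add: power2_eq_square sum_product sum.distrib)
  then show ?thesis
    by (simp add: e sum.distrib sum_subtractf sum_distrib_left[symmetric])
qed

definition unit_mat :: "nat \<Rightarrow> nat \<Rightarrow> nat \<Rightarrow> complex mat" where
  "unit_mat n a b = mat n n (\<lambda>(i, j). if i = a \<and> j = b then 1 else 0)"

lemma unit_mat_carrier [simp]: "unit_mat n a b \<in> carrier_mat n n"
  by (simp add: unit_mat_def)

lemma partial_tr_unit_mat:
  assumes "a < n" "b < n" "u < k" "v < k"
  shows "partial_tr n k (unit_mat n a b) \<rho> $$ (u, v) = \<rho> $$ (b * k + u, a * k + v)"
proof -
  have "partial_tr n k (unit_mat n a b) \<rho> $$ (u, v)
      = (\<Sum>i<n. \<Sum>j<n. unit_mat n a b $$ (i, j) * \<rho> $$ (j * k + u, i * k + v))"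
    using assms by (intro partial_tr_index) auto
  also have "\<dots> = (\<Sum>i<n. \<Sum>j<n. if j = b then (if i = a then \<rho> $$ (j * k + u, i * k + v) else 0) else 0)"
    by (intro sum.cong refl) (simp add: unit_mat_def)
  also have "\<dots> = \<rho> $$ (b * k + u, a * k + v)" using assms by simp
  finally show ?thesis .
qed

text \<open>The images of the matrix units are the \<open>k\<close> by \<open>k\<close> blocks of
  \<open>rho\<close>, which together tile \<open>rho\<close>.\<close>

lemma frob2_partial_tr_unit_mat:
  assumes "\<rho> \<in> carrier_mat (n * k) (n * k)"
  shows "(\<Sum>a<n. \<Sum>b<n. frob2 (partial_tr n k (unit_mat n a b) \<rho>)) = frob2 \<rho>"
proof -
  have "(\<Sum>a<n. \<Sum>b<n. frob2 (partial_tr n k (unit_mat n a b) \<rho>))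
      = (\<Sum>a<n. \<Sum>b<n. \<Sum>u<k. \<Sum>v<k. (cmod (\<rho> $$ (b * k + u, a * k + v)))\<^sup>2)"
    by (simp add: frob2_def partial_tr_unit_mat)
  also have "\<dots> = (\<Sum>b<n. \<Sum>a<n. \<Sum>u<k. \<Sum>v<k. (cmod (\<rho> $$ (b * k + u, a * k + v)))\<^sup>2)"
    by (rule sum.swap)
  also have "\<dots> = (\<Sum>b<n. \<Sum>u<k. \<Sum>a<n. \<Sum>v<k. (cmod (\<rho> $$ (b * k + u, a * k + v)))\<^sup>2)"
    by (rule sum.cong[OF refl], rule sum.swap)
  also have "\<dots> = frob2 \<rho>"
    using assms by (simp add: frob2_def sum_lessThan_mult)
  finally show ?thesis .
qed

lemma frob2_partial_tr_diagonal:
  "(\<Sum>a<n. \<Sum>b<n. frob2 (partial_tr n k (unit_mat n a a + (- 1) \<cdot>\<^sub>m unit_mat n b b) \<rho>))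
   = 2 * real n * (\<Sum>a<n. frob2 (partial_tr n k (unit_mat n a a) \<rho>)) - 2 * frob2 (partial_tr n k (1\<^sub>m n) \<rho>)"
proof -
  let ?x = "\<lambda>u v a. \<rho> $$ (a * k + u, a * k + v)"
  have one: "partial_tr n k (1\<^sub>m n) \<rho> $$ (u, v) = (\<Sum>a<n. ?x u v a)" if "u < k" "v < k" for u v
  proof -
    have "partial_tr n k (1\<^sub>m n) \<rho> $$ (u, v) = (\<Sum>i<n. \<Sum>j<n. 1\<^sub>m n $$ (i, j) * \<rho> $$ (j * k + u, i * k + v))"
      using that by (intro partial_tr_index) auto
    also have "\<dots> = (\<Sum>i<n. \<Sum>j<n. if i = j then ?x u v i else 0)" by (intro sum.cong refl) simp
    finally show ?thesis by simp
  qed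
  have "(\<Sum>a<n. \<Sum>b<n. frob2 (partial_tr n k (unit_mat n a a + (- 1) \<cdot>\<^sub>m unit_mat n b b) \<rho>))
      = (\<Sum>a<n. \<Sum>b<n. \<Sum>u<k. \<Sum>v<k. (cmod (?x u v a - ?x u v b))\<^sup>2)"
    by (intro sum.cong refl) (simp add: partial_tr_add partial_tr_smult frob2_def partial_tr_unit_mat)
  also have "\<dots> = (\<Sum>u<k. \<Sum>v<k. \<Sum>a<n. \<Sum>b<n. (cmod (?x u v a - ?x u v b))\<^sup>2)"
    by (rule sum4_swap)
  also have "\<dots> = 2 * real n * (\<Sum>u<k. \<Sum>v<k. \<Sum>a<n. (cmod (?x u v a))\<^sup>2) - 2 * (\<Sum>u<k. \<Sum>v<k. (cmod (\<Sum>a<n. ?x u v a))\<^sup>2)"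
    by (simp add: sum_sum_cmod_diff sum_subtractf sum_distrib_left)
  also have "(\<Sum>u<k. \<Sum>v<k. \<Sum>a<n. (cmod (?x u v a))\<^sup>2) = (\<Sum>a<n. \<Sum>u<k. \<Sum>v<k. (cmod (?x u v a))\<^sup>2)"
    by (rule sum3_swap)
  also have "\<dots> = (\<Sum>a<n. frob2 (partial_tr n k (unit_mat n a a) \<rho>))"
    by (simp add: frob2_def partial_tr_unit_mat)
  also have "(\<Sum>u<k. \<Sum>v<k. (cmod (\<Sum>a<n. ?x u v a))\<^sup>2) = frob2 (partial_tr n k (1\<^sub>m n) \<rho>)"
    by (simp add: frob2_def one)
  finally show ?thesis .
qed

text \<open>The average of \<open>frob2 (partial_tr n k X \<rho>)\<close> over an orthonormal basis of the traceless
  matrices is \<open>(frob2 \<rho> - frob2 (partial_tr n k 1 \<rho>) / n) / (n\<^sup>2 - 1)\<close>. The matrices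
  \<open>E\<^sub>a\<^sub>b\<close> and \<open>E\<^sub>a\<^sub>a - E\<^sub>b\<^sub>b\<close> with \<open>a \<noteq> b\<close> form a tight frame that replaces such a basis.\<close>

lemma exists_traceless_below_average:
  assumes n: "n \<ge> 2" and R: "\<rho> \<in> carrier_mat (n * k) (n * k)"
  obtains X where "X \<in> carrier_mat n n" "mtrace X = 0" "0 < frob2 X"
    "frob2 (partial_tr n k X \<rho>)
       \<le> (frob2 \<rho> - frob2 (partial_tr n k (1\<^sub>m n) \<rho>) / real n) / ((real n)\<^sup>2 - 1) * frob2 X"
proof -
  let ?T = "\<lambda>X. frob2 (partial_tr n k X \<rho>)"
  let ?E = "unit_mat n"
  let ?D = "\<lambda>a b. ?E a a + (- 1) \<cdot>\<^sub>m ?E b b"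
  define S where "S = (frob2 \<rho> - ?T (1\<^sub>m n) / real n) / ((real n)\<^sup>2 - 1)"
  have n1: "(real n)\<^sup>2 - 1 > 0" using n power_mono[of 2 "real n" 2] by simp
  have "\<exists>X \<in> carrier_mat n n. mtrace X = 0 \<and> 0 < frob2 X \<and> ?T X \<le> S * frob2 X"
  proof (rule ccontr)
    assume "\<not> ?thesis"
    then have gt: "S * frob2 X < ?T X" if "X \<in> carrier_mat n n" "mtrace X = 0" "0 < frob2 X" for X
      using that by (meson not_le)
    have E: "mtrace (?E a b) = 0" "frob2 (?E a b) = 1" if "a < n" "b < n" "a \<noteq> b" for a b
    proof -
      show "mtrace (?E a b) = 0" using that by (simp add: mtrace_def unit_mat_def)
      have "frob2 (?E a b) = (\<Sum>i<n. \<Sum>j<n. if j = b then (if i = a then 1 else 0) else 0)"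
        unfolding frob2_carrier[OF unit_mat_carrier] by (intro sum.cong refl) (simp add: unit_mat_def)
      then show "frob2 (?E a b) = 1" using that by simp
    qed
    have D: "mtrace (?D a b) = 0" "frob2 (?D a b) = 2" "?D a b \<in> carrier_mat n n" if "a < n" "b < n" "a \<noteq> b" for a b
    proof -
      show C: "?D a b \<in> carrier_mat n n" by simp
      have "mtrace (?D a b) = (\<Sum>i<n. (if i = a then 1 else 0) - (if i = b then 1 else 0))"
        unfolding mtrace_def by (intro sum.cong) (auto simp: unit_mat_def)
      then show "mtrace (?D a b) = 0" using that by (simp add: sum_subtractf)
      have "frob2 (?D a b) = (\<Sum>i<n. \<Sum>j<n. if j = i then (if i = a then 1 else 0) + (if i = b then 1 else 0) else 0)"
        unfolding frob2_carrier[OF C] using that by (intro sum.cong refl) (auto simp: unit_mat_def)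
      then show "frob2 (?D a b) = 2" using that by (simp add: sum.distrib)
    qed
    have EE: "S * (if a = b then 0 else 1) \<le> (if a = b then 0 else ?T (?E a b))" if "a < n" "b < n" for a b
      using gt[of "?E a b"] E that by auto
    have DD: "S * (if a = b then 0 else 2) \<le> (if a = b then 0 else ?T (?D a b))" if "a < n" "b < n" for a b
      using gt[of "?D a b"] D that by auto
    have count: "(\<Sum>a<n. \<Sum>b<n. if a = b then 0 else c) = (real n)\<^sup>2 * c - real n * c" for c :: real
    proof -
      have "(\<Sum>a<n. \<Sum>b<n. if a = b then 0 else c) = (\<Sum>a<n. \<Sum>b<n. c - (if a = b then c else 0))"
        by (intro sum.cong refl) simp
      then show ?thesis by (simp add: sum_subtractf power2_eq_square algebra_simps)
    qed
    \<comment> \<open>One strict inequality is enough for the contradiction; the pair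
      \<open>(0, 1)\<close>, available since \<open>n >= 2\<close>, supplies it.\<close>
    have "(\<Sum>a<n. \<Sum>b<n. S * (if a = b then 0 else 1)) < (\<Sum>a<n. \<Sum>b<n. (if a = b then 0 else ?T (?E a b)))"
    proof (rule sum_strict_mono_ex1)
      show "\<forall>a\<in>{..<n}. (\<Sum>b<n. S * (if a = b then 0 else 1)) \<le> (\<Sum>b<n. (if a = b then 0 else ?T (?E a b)))"
        using EE by (auto intro!: sum_mono)
      have "(\<Sum>b<n. S * (if 0 = b then 0 else 1)) < (\<Sum>b<n. (if 0 = b then 0 else ?T (?E 0 b)))"
      proof (rule sum_strict_mono_ex1)
        show "\<forall>b\<in>{..<n}. S * (if 0 = b then 0 else 1) \<le> (if 0 = b then 0 else ?T (?E 0 b))"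
          using EE[of 0] n by (intro ballI) simp
        show "\<exists>b\<in>{..<n}. S * (if 0 = b then 0 else 1) < (if 0 = b then 0 else ?T (?E 0 b))"
          using gt[of "?E 0 1"] E[of 0 1] n by (intro bexI[of _ 1]) auto
      qed simp
      then show "\<exists>a\<in>{..<n}. (\<Sum>b<n. S * (if a = b then 0 else 1)) < (\<Sum>b<n. (if a = b then 0 else ?T (?E a b)))"
        using n by (intro bexI[of _ 0]) auto
    qed simp
    then have 1: "S * ((real n)\<^sup>2 - real n) < (\<Sum>a<n. \<Sum>b<n. (if a = b then 0 else ?T (?E a b)))"
      by (simp add: sum_distrib_left[symmetric] count)
    have 2: "(\<Sum>a<n. \<Sum>b<n. (if a = b then 0 else ?T (?E a b))) = frob2 \<rho> - (\<Sum>a<n. ?T (?E a a))"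
    proof -
      have "(\<Sum>a<n. \<Sum>b<n. (if a = b then 0 else ?T (?E a b)))
          = (\<Sum>a<n. \<Sum>b<n. ?T (?E a b) - (if a = b then ?T (?E a a) else 0))"
        by (intro sum.cong refl) simp
      also have "\<dots> = (\<Sum>a<n. \<Sum>b<n. ?T (?E a b)) - (\<Sum>a<n. ?T (?E a a))"
        by (simp add: sum_subtractf)
      finally show ?thesis by (simp add: frob2_partial_tr_unit_mat[OF R])
    qed
    have "(\<Sum>a<n. \<Sum>b<n. S * (if a = b then 0 else 2)) \<le> (\<Sum>a<n. \<Sum>b<n. (if a = b then 0 else ?T (?D a b)))"
      using DD by (intro sum_mono) auto
    also have "\<dots> \<le> (\<Sum>a<n. \<Sum>b<n. ?T (?D a b))"
      by (intro sum_mono) (simp add: frob2_nonneg)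
    also have "\<dots> = 2 * real n * (\<Sum>a<n. ?T (?E a a)) - 2 * ?T (1\<^sub>m n)"
      by (rule frob2_partial_tr_diagonal)
    finally have "S * ((real n)\<^sup>2 * 2 - real n * 2) \<le> 2 * real n * (\<Sum>a<n. ?T (?E a a)) - 2 * ?T (1\<^sub>m n)"
      by (simp add: sum_distrib_left[symmetric] count)
    \<comment> \<open>Division by \<open>2 n\<close> gives the diagonal frame its weight; in the sum
      with the off-diagonal inequality the terms of \<open>E_aa\<close> cancel.\<close>
    then have "S * (real n - 1) \<le> (\<Sum>a<n. ?T (?E a a)) - ?T (1\<^sub>m n) / real n"
      using n by (simp add: field_simps power2_eq_square)
    then have "S * ((real n)\<^sup>2 - 1) < frob2 \<rho> - ?T (1\<^sub>m n) / real n"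
      using 1 unfolding 2 by (simp add: algebra_simps)
    then show False using n1 by (simp add: S_def)
  qed
  then show ?thesis using that unfolding S_def by blast
qed

text \<open>The image of the identity is the marginal on B, of trace 1; Cauchy-Schwarz on its
  diagonal bounds its purity below by \<open>1/k\<close>.\<close>

lemma frob2_partial_tr_one:
  assumes R: "density_operator (n * k) \<rho>"
  shows "1 \<le> real k * frob2 (partial_tr n k (1\<^sub>m n) \<rho>)"
proof -
  let ?M = "partial_tr n k (1\<^sub>m n) \<rho>"
  have RC: "\<rho> \<in> carrier_mat (n * k) (n * k)" using R by (simp add: density_operator_def psd_def)
  have "mtrace ?M = (\<Sum>b<k. \<Sum>i<n. \<rho> $$ (i * k + b, i * k + b))"
  proof -
    have "?M $$ (b, b) = (\<Sum>i<n. \<rho> $$ (i * k + b, i * k + b))" if "b < k" for b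
    proof -
      have "?M $$ (b, b) = (\<Sum>i<n. \<Sum>j<n. 1\<^sub>m n $$ (i, j) * \<rho> $$ (j * k + b, i * k + b))"
        using that by (intro partial_tr_index) auto
      also have "\<dots> = (\<Sum>i<n. \<Sum>j<n. if i = j then \<rho> $$ (i * k + b, i * k + b) else 0)" by (intro sum.cong refl) simp
      finally show ?thesis by simp
    qed
    then show ?thesis by (simp add: mtrace_def)
  qed
  also have "\<dots> = (\<Sum>i<n. \<Sum>b<k. \<rho> $$ (i * k + b, i * k + b))" by (rule sum.swap)
  also have "\<dots> = mtrace \<rho>" using RC by (simp add: mtrace_def sum_lessThan_mult)
  finally have "mtrace ?M = 1" using R by (simp add: density_operator_def)
  then have "1 = cmod (\<Sum>b<k. ?M $$ (b, b))" by (simp add: mtrace_def)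
  also have "\<dots> \<le> (\<Sum>b<k. cmod (?M $$ (b, b)))" by (rule norm_sum)
  finally have "1\<^sup>2 \<le> (\<Sum>b<k. cmod (?M $$ (b, b)))\<^sup>2" by (intro power_mono) auto
  also have "\<dots> \<le> real k * (\<Sum>b<k. (cmod (?M $$ (b, b)))\<^sup>2)"
    using sum_mset_Cauchy_Schwarz[of "image_mset (\<lambda>b. cmod (?M $$ (b, b))) (mset_set {..<k})"]
    by (simp add: sum_unfold_sum_mset image_mset.compositionality comp_def)
  also have "\<dots> \<le> real k * frob2 ?M"
    unfolding frob2_carrier[OF partial_tr_carrier]
    by (auto intro!: mult_left_mono sum_mono member_le_sum[where f = "\<lambda>c. (cmod (?M $$ (_, c)))\<^sup>2"])
  finally show ?thesis by simp
qed

section \<open>Operator Schmidt coefficients\<close>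

lemma hs_inner_sum:
  assumes "A \<in> carrier_mat n m" "B \<in> carrier_mat n m"
  shows "hs_inner A B = (\<Sum>i<n. \<Sum>j<m. cnj (A $$ (i, j)) * B $$ (i, j))"
proof -
  have "hs_inner A B = (\<Sum>j<m. \<Sum>i<n. mat_adjoint A $$ (j, i) * B $$ (i, j))"
    unfolding hs_inner_def using assms by (intro mtrace_mult) auto
  also have "\<dots> = (\<Sum>j<m. \<Sum>i<n. cnj (A $$ (i, j)) * B $$ (i, j))"
    using assms by (intro sum.cong refl) auto
  also have "\<dots> = (\<Sum>i<n. \<Sum>j<m. cnj (A $$ (i, j)) * B $$ (i, j))" by (rule sum.swap)
  finally show ?thesis .
qed

lemma hs_inner_commute:
  assumes "A \<in> carrier_mat n m" "B \<in> carrier_mat n m"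
  shows "hs_inner A B = cnj (hs_inner B A)"
  using assms by (simp add: hs_inner_sum[of _ n m] mult.commute)

lemma hs_inner_lincomb:
  assumes A: "A \<in> carrier_mat n m" and Y: "Y \<in> carrier_mat n m"
    and G: "\<And>i. i < N \<Longrightarrow> G i \<in> carrier_mat n m"
    and eq: "\<And>a b. a < n \<Longrightarrow> b < m \<Longrightarrow> Y $$ (a, b) = (\<Sum>i<N. c i * G i $$ (a, b))"
  shows "hs_inner A Y = (\<Sum>i<N. c i * hs_inner A (G i))"
proof -
  have "hs_inner A Y = (\<Sum>a<n. \<Sum>b<m. \<Sum>i<N. c i * (cnj (A $$ (a, b)) * G i $$ (a, b)))"
    unfolding hs_inner_sum[OF A Y]
    by (intro sum.cong refl) (simp add: eq sum_distrib_left mult_ac)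
  also have "\<dots> = (\<Sum>i<N. \<Sum>a<n. \<Sum>b<m. c i * (cnj (A $$ (a, b)) * G i $$ (a, b)))"
    by (rule sum3_swap)
  also have "\<dots> = (\<Sum>i<N. c i * hs_inner A (G i))"
    using A G by (intro sum.cong refl) (simp add: hs_inner_sum[of _ n m] sum_distrib_left)
  finally show ?thesis .
qed

lemma hs_basis_expansion:
  assumes G: "hs_orthonormal_basis d G" and Y: "Y \<in> carrier_mat d d"
    and eq: "\<And>a b. a < d \<Longrightarrow> b < d \<Longrightarrow> Y $$ (a, b) = (\<Sum>i<d\<^sup>2. c i * G i $$ (a, b))"
  shows "j < d\<^sup>2 \<Longrightarrow> hs_inner (G j) Y = c j" and "frob2 Y = (\<Sum>i<d\<^sup>2. (cmod (c i))\<^sup>2)"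
proof -
  have GC: "G i \<in> carrier_mat d d" if "i < d\<^sup>2" for i
    using G that by (simp add: hs_orthonormal_basis_def)
  have coeff: "hs_inner (G j) Y = c j" if "j < d\<^sup>2" for j
  proof -
    have "hs_inner (G j) Y = (\<Sum>i<d\<^sup>2. c i * hs_inner (G j) (G i))"
      using that by (intro hs_inner_lincomb[OF GC Y GC eq])
    also have "\<dots> = (\<Sum>i<d\<^sup>2. if j = i then c i else 0)"
      using G that by (intro sum.cong refl) (auto simp: hs_orthonormal_basis_def)
    finally show ?thesis using that by simp
  qed
  then show "j < d\<^sup>2 \<Longrightarrow> hs_inner (G j) Y = c j" .
  have "complex_of_real (frob2 Y) = hs_inner Y Y" by (simp add: hs_inner_def mtrace_adjoint_mult)
  also have "\<dots> = (\<Sum>i<d\<^sup>2. c i * hs_inner Y (G i))"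
    by (intro hs_inner_lincomb[OF Y Y GC eq])
  also have "\<dots> = (\<Sum>i<d\<^sup>2. complex_of_real ((cmod (c i))\<^sup>2))"
  proof (intro sum.cong refl)
    fix i assume "i \<in> {..<d\<^sup>2}"
    then have i: "i < d\<^sup>2" by simp
    then have "hs_inner Y (G i) = cnj (c i)"
      using hs_inner_commute[OF Y GC[OF i]] coeff by simp
    then show "c i * hs_inner Y (G i) = complex_of_real ((cmod (c i))\<^sup>2)"
      by (simp add: complex_norm_square flip: of_real_power)
  qed
  finally have "complex_of_real (frob2 Y) = complex_of_real (\<Sum>i<d\<^sup>2. (cmod (c i))\<^sup>2)" by simp
  then show "frob2 Y = (\<Sum>i<d\<^sup>2. (cmod (c i))\<^sup>2)" by (simp only: of_real_eq_iff)
qed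

lemma hs_basis_Parseval:
  assumes G: "hs_orthonormal_basis d G" and Y: "Y \<in> carrier_mat d d"
  shows "(\<Sum>j<d\<^sup>2. (cmod (hs_inner (G j) Y))\<^sup>2) = frob2 Y"
proof -
  obtain c where eq: "\<And>a b. a < d \<Longrightarrow> b < d \<Longrightarrow> Y $$ (a, b) = (\<Sum>i<d\<^sup>2. c i * G i $$ (a, b))"
    using G Y unfolding hs_orthonormal_basis_def by meson
  show ?thesis using hs_basis_expansion[OF G Y eq] by simp
qed

text \<open>This exhibits the correlation matrix as the matrix of the conjugate-linear map
  \<open>X -> Tr_A (X^* rho)\<close>.\<close>

lemma hs_inner_kron:
  assumes X: "X \<in> carrier_mat n n" and Y: "Y \<in> carrier_mat k k" and R: "\<rho> \<in> carrier_mat (n * k) (n * k)"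
  shows "hs_inner (kron X Y) \<rho> = hs_inner Y (partial_tr n k (mat_adjoint X) \<rho>)"
proof -
  let ?f = "\<lambda>i j b c. cnj (X $$ (i, j)) * cnj (Y $$ (b, c)) * \<rho> $$ (i * k + b, j * k + c)"
  have K: "kron X Y \<in> carrier_mat (n * k) (n * k)" using X Y by (simp add: kron_def)
  have "hs_inner (kron X Y) \<rho> = (\<Sum>p<n*k. \<Sum>q<n*k. cnj (kron X Y $$ (p, q)) * \<rho> $$ (p, q))"
    by (rule hs_inner_sum[OF K R])
  also have "\<dots> = (\<Sum>i<n. \<Sum>b<k. \<Sum>j<n. \<Sum>c<k. ?f i j b c)"
    unfolding sum_lessThan_mult
  proof (intro sum.cong refl)
    fix i b j c assume "i \<in> {..<n}" "b \<in> {..<k}" "j \<in> {..<n}" "c \<in> {..<k}"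
    then have l: "i < n" "b < k" "j < n" "c < k" by auto
    then show "cnj (kron X Y $$ (i * k + b, j * k + c)) * \<rho> $$ (i * k + b, j * k + c) = ?f i j b c"
      using X Y pair_index_less[of i n b k] pair_index_less[of j n c k] by (simp add: kron_def)
  qed
  also have "\<dots> = (\<Sum>i<n. \<Sum>j<n. \<Sum>b<k. \<Sum>c<k. ?f i j b c)"
    by (rule sum.cong[OF refl], rule sum.swap)
  also have "\<dots> = (\<Sum>b<k. \<Sum>c<k. \<Sum>i<n. \<Sum>j<n. ?f i j b c)" by (rule sum4_swap)
  also have "\<dots> = (\<Sum>b<k. \<Sum>c<k. \<Sum>j<n. \<Sum>i<n. ?f i j b c)"
    by (rule sum.cong[OF refl], rule sum.cong[OF refl], rule sum.swap)
  also have "\<dots> = (\<Sum>b<k. \<Sum>c<k. cnj (Y $$ (b, c)) * partial_tr n k (mat_adjoint X) \<rho> $$ (b, c))"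
    using X by (intro sum.cong refl) (simp add: partial_tr_index[of _ n] sum_distrib_left mult_ac)
  also have "\<dots> = hs_inner Y (partial_tr n k (mat_adjoint X) \<rho>)"
    by (rule hs_inner_sum[OF Y partial_tr_carrier, symmetric])
  finally show ?thesis .
qed

lemma partial_tr_adjoint_index:
  "b < k \<Longrightarrow> c < k \<Longrightarrow> partial_tr n k (mat_adjoint X) \<rho> $$ (b, c) = hs_inner X (block n k b c \<rho>)"
  by (simp add: partial_tr_def hs_inner_def)

context
  fixes d :: nat and F G :: "nat \<Rightarrow> complex mat" and \<rho> :: "complex mat"
  assumes F: "hs_orthonormal_basis d F" and G: "hs_orthonormal_basis d G"
    and R: "\<rho> \<in> carrier_mat (d * d) (d * d)"
begin

lemma basis_carrier: "i < d\<^sup>2 \<Longrightarrow> F i \<in> carrier_mat d d" "i < d\<^sup>2 \<Longrightarrow> G i \<in> carrier_mat d d"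
  using F G by (auto simp: hs_orthonormal_basis_def)

lemma correlation_matrix_index:
  assumes "i < d\<^sup>2" "j < d\<^sup>2"
  shows "correlation_matrix d F G \<rho> $$ (i, j) = hs_inner (G j) (partial_tr d d (mat_adjoint (F i)) \<rho>)"
  using assms by (simp add: correlation_matrix_def hs_inner_kron[OF basis_carrier R])

text \<open>Parseval twice: in the basis \<open>G\<close> for each row, then in the basis
  \<open>F\<close> for each block of \<open>rho\<close>.\<close>

lemma frob2_correlation_matrix: "frob2 (correlation_matrix d F G \<rho>) = frob2 \<rho>"
proof -
  have "frob2 (correlation_matrix d F G \<rho>)
      = (\<Sum>i<d\<^sup>2. \<Sum>j<d\<^sup>2. (cmod (hs_inner (G j) (partial_tr d d (mat_adjoint (F i)) \<rho>)))\<^sup>2)"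
    by (subst frob2_carrier[of _ "d\<^sup>2" "d\<^sup>2"]) (auto simp: correlation_matrix_index correlation_matrix_def[of d F G] intro!: sum.cong simp flip: correlation_matrix_index)
  also have "\<dots> = (\<Sum>i<d\<^sup>2. frob2 (partial_tr d d (mat_adjoint (F i)) \<rho>))"
    by (simp add: hs_basis_Parseval[OF G])
  also have "\<dots> = (\<Sum>i<d\<^sup>2. \<Sum>b<d. \<Sum>c<d. (cmod (hs_inner (F i) (block d d b c \<rho>)))\<^sup>2)"
    by (simp add: frob2_def partial_tr_adjoint_index)
  also have "\<dots> = (\<Sum>b<d. \<Sum>c<d. \<Sum>i<d\<^sup>2. (cmod (hs_inner (F i) (block d d b c \<rho>)))\<^sup>2)"
    by (rule sum3_swap[symmetric])
  also have "\<dots> = (\<Sum>b<d. \<Sum>c<d. \<Sum>i<d. \<Sum>j<d. (cmod (\<rho> $$ (i * d + b, j * d + c)))\<^sup>2)"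
    by (simp add: hs_basis_Parseval[OF F]) (simp add: frob2_def block_def)
  also have "\<dots> = (\<Sum>i<d. \<Sum>j<d. \<Sum>b<d. \<Sum>c<d. (cmod (\<rho> $$ (i * d + b, j * d + c)))\<^sup>2)"
    by (rule sum4_swap)
  also have "\<dots> = (\<Sum>i<d. \<Sum>b<d. \<Sum>j<d. \<Sum>c<d. (cmod (\<rho> $$ (i * d + b, j * d + c)))\<^sup>2)"
    by (rule sum.cong[OF refl], rule sum.swap)
  also have "\<dots> = frob2 \<rho>" using R by (simp add: frob2_def sum_lessThan_mult)
  finally show ?thesis .
qed

text \<open>By conjugate linearity, component \<open>j\<close> of \<open>C^* w\<close> is the
  conjugate of the coefficient of \<open>Tr_A (X^* rho)\<close> along \<open>G j\<close>; Parseval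
  turns this into equal norms.\<close>

lemma correlation_matrix_left_vector:
  assumes w: "w \<in> carrier_vec (d\<^sup>2)"
  defines "X \<equiv> mat d d (\<lambda>(a, b). \<Sum>i<d\<^sup>2. w $ i * F i $$ (a, b))"
  shows "vnorm2 (mat_adjoint (correlation_matrix d F G \<rho>) *\<^sub>v w) = frob2 (partial_tr d d (mat_adjoint X) \<rho>)"
    and "vnorm2 w = frob2 X"
proof -
  let ?C = "correlation_matrix d F G \<rho>"
  let ?T = "\<lambda>X. partial_tr d d (mat_adjoint X) \<rho>"
  have X: "X \<in> carrier_mat d d" by (simp add: X_def)
  have eq: "X $$ (a, b) = (\<Sum>i<d\<^sup>2. w $ i * F i $$ (a, b))" if "a < d" "b < d" for a b
    using that by (simp add: X_def)
  show "vnorm2 w = frob2 X"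
    using hs_basis_expansion(2)[OF F X eq] w by (simp add: vnorm2_def)
  have T: "?T X $$ (b, c) = (\<Sum>i<d\<^sup>2. cnj (w $ i) * ?T (F i) $$ (b, c))" if "b < d" "c < d" for b c
  proof -
    let ?B = "block d d b c \<rho>"
    have "?T X $$ (b, c) = cnj (hs_inner ?B X)"
      using that hs_inner_commute[OF X, of ?B] by (simp add: partial_tr_adjoint_index)
    also have "hs_inner ?B X = (\<Sum>i<d\<^sup>2. w $ i * hs_inner ?B (F i))"
      by (intro hs_inner_lincomb[OF _ X _ eq]) (auto simp: basis_carrier)
    also have "cnj \<dots> = (\<Sum>i<d\<^sup>2. cnj (w $ i) * ?T (F i) $$ (b, c))"
      unfolding cnj_sum complex_cnj_mult
    proof (intro sum.cong refl)
      fix i assume "i \<in> {..<d\<^sup>2}"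
      then have "F i \<in> carrier_mat d d" using basis_carrier by simp
      then show "cnj (w $ i) * cnj (hs_inner ?B (F i)) = cnj (w $ i) * ?T (F i) $$ (b, c)"
        using that hs_inner_commute[of "F i" d d ?B] by (simp add: partial_tr_adjoint_index)
    qed
    finally show ?thesis .
  qed
  have CC: "?C \<in> carrier_mat (d\<^sup>2) (d\<^sup>2)" by (simp add: correlation_matrix_def)
  have e: "(mat_adjoint ?C *\<^sub>v w) $ j = cnj (hs_inner (G j) (?T X))" if j: "j < d\<^sup>2" for j
  proof -
    have "hs_inner (G j) (?T X) = (\<Sum>i<d\<^sup>2. cnj (w $ i) * hs_inner (G j) (?T (F i)))"
      using j by (intro hs_inner_lincomb[OF basis_carrier(2) partial_tr_carrier partial_tr_carrier T])
    also have "\<dots> = (\<Sum>i<d\<^sup>2. cnj (w $ i) * ?C $$ (i, j))"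
      using j by (simp add: correlation_matrix_index)
    finally show ?thesis
      using j w CC by (simp add: scalar_prod_def atLeast0LessThan mult.commute)
  qed
  have "vnorm2 (mat_adjoint ?C *\<^sub>v w) = (\<Sum>j<d\<^sup>2. (cmod (hs_inner (G j) (?T X)))\<^sup>2)"
    using CC e by (simp add: vnorm2_def)
  then show "vnorm2 (mat_adjoint ?C *\<^sub>v w) = frob2 (?T X)"
    by (simp add: hs_basis_Parseval[OF G])
qed

end

text \<open>The eigenvectors of \<open>C^* C\<close> live on the B side, while an observable on A
  needs a vector for \<open>C^*\<close>. For \<open>s\<close> nonzero \<open>C v\<close> serves; for
  \<open>s = 0\<close> it vanishes, and since \<open>C\<close> is square \<open>C^*\<close> has a
  kernel vector as well.\<close>

lemma singular_value_left_vector: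
  assumes C: "C \<in> carrier_mat n n" and s: "s \<in># singular_values C"
  obtains w where "w \<in> carrier_vec n" "0 < vnorm2 w" "vnorm2 (mat_adjoint C *\<^sub>v w) = s\<^sup>2 * vnorm2 w"
proof -
  have pos: "0 < vnorm2 w \<longleftrightarrow> w \<noteq> 0\<^sub>v n" if "w \<in> carrier_vec n" for w
    using vnorm2_eq_0_iff[OF that] vnorm2_nonneg[of w] by auto
  obtain z where z: "z \<in># proots (char_poly (mat_adjoint C * C))" "s = sqrt (Re z)"
    using s unfolding singular_values_def by auto
  have s2: "s\<^sup>2 = Re z" using z proots_gram(2)[OF C z(1)] by simp
  obtain v where v: "v \<in> carrier_vec n" "v \<noteq> 0\<^sub>v n" "mat_adjoint C *\<^sub>v (C *\<^sub>v v) = z \<cdot>\<^sub>v v"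
    "vnorm2 (C *\<^sub>v v) = Re z * vnorm2 v"
    using proots_gram(3)[OF C z(1)] by blast
  have Cv: "C *\<^sub>v v \<in> carrier_vec n" using C v by simp
  show thesis
  proof (cases "s = 0")
    case False
    have zz: "cmod z = Re z" using proots_gram(1,2)[OF C z(1)] by (metis abs_of_nonneg norm_of_real)
    have "vnorm2 (mat_adjoint C *\<^sub>v (C *\<^sub>v v)) = (cmod z)\<^sup>2 * vnorm2 v"
      unfolding v(3) by (simp add: vnorm2_def norm_mult power_mult_distrib sum_distrib_left)
    then have "vnorm2 (mat_adjoint C *\<^sub>v (C *\<^sub>v v)) = s\<^sup>2 * vnorm2 (C *\<^sub>v v)"
      using v(4) s2 zz by (simp add: power2_eq_square)
    moreover have "0 < vnorm2 (C *\<^sub>v v)"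
      using False v(4) s2 pos[OF v(1)] v(2) by (simp add: zero_less_mult_iff) (metis zero_less_power2)
    ultimately show ?thesis using that Cv by blast
  next
    case True
    then have "vnorm2 (C *\<^sub>v v) = 0" using v(4) s2 by simp
    then have "C *\<^sub>v v = 0\<^sub>v n" using vnorm2_eq_0_iff[OF Cv] by simp
    then have "det C = 0" using det_0_iff_vec_prod_zero[OF C] v by blast
    then have "det (transpose_mat C) = 0" using det_transpose[OF C] by simp
    then obtain x where x: "x \<in> carrier_vec n" "x \<noteq> 0\<^sub>v n" "transpose_mat C *\<^sub>v x = 0\<^sub>v n"
      using det_0_iff_vec_prod_zero[of "transpose_mat C" n] C by auto
    \<comment> \<open>Conjugation carries the kernel of the transpose to the kernel of the
      adjoint.\<close>
    have "(mat_adjoint C *\<^sub>v conjugate x) $ j = 0" if "j < n" for j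
    proof -
      have "(mat_adjoint C *\<^sub>v conjugate x) $ j = cnj ((transpose_mat C *\<^sub>v x) $ j)"
        using that C x(1) by (simp add: scalar_prod_def)
      then show ?thesis using x(3) that by simp
    qed
    then have "vnorm2 (mat_adjoint C *\<^sub>v conjugate x) = 0" using C by (simp add: vnorm2_def)
    moreover have "0 < vnorm2 (conjugate x)" using pos[OF x(1)] x(2) by (simp add: vnorm2_def)
    ultimately show ?thesis using that[of "conjugate x"] x(1) True by simp
  qed
qed

text \<open>The \<open>n\<close> squared singular values sum to \<open>frob2 F\<close>, so some
  \<open>s\<close> has \<open>frob2 F <= n * s^2\<close>. As \<open>F\<close> is Hermitian,
  \<open>F^2 v = s^2 v\<close>, and the factorization \<open>(F - s) (F + s) v = 0\<close> yields an
  eigenvector for \<open>s\<close> or \<open>- s\<close>.\<close>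

lemma hermitian_large_quad_form:
  assumes F: "hermitian_mat n F" "0 < frob2 F"
  obtains v y where "(\<Sum>i<n. (cmod (v i))\<^sup>2) = 1" "quad_form n F v = complex_of_real y"
    "frob2 F \<le> real n * y\<^sup>2"
proof -
  have FC: "F \<in> carrier_mat n n" using F by (simp add: hermitian_mat_def)
  have adj: "mat_adjoint F = F"
  proof (rule eq_matI)
    fix i j assume "i < dim_row F" "j < dim_col F"
    then show "mat_adjoint F $$ (i, j) = F $$ (i, j)"
      using F(1) unfolding hermitian_mat_def by (metis carrier_matD complex_cnj_cnj mat_adjoint_index)
  qed (use FC in auto)
  note sv = singular_values_facts[OF FC]
  have "\<exists>s\<in>#singular_values F. frob2 F \<le> real n * s\<^sup>2"
  proof (rule ccontr)
    assume "\<not> ?thesis"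
    then have lt: "real n * s\<^sup>2 < frob2 F" if "s \<in># singular_values F" for s using that by force
    have gen: "(\<Sum>s\<in>#S. real n * s\<^sup>2) < real (size S) * frob2 F"
      if "\<And>s. s \<in># S \<Longrightarrow> real n * s\<^sup>2 < frob2 F" "S \<noteq> {#}" for S
      using that
    proof (induction S)
      case (add s S)
      then show ?case
        by (cases "S = {#}") (auto simp: algebra_simps intro: add_strict_mono)
    qed simp
    have "n \<noteq> 0"
    proof
      assume "n = 0"
      then have "frob2 F = 0" using FC by (simp add: frob2_def)
      then show False using F(2) by simp
    qed
    then have "singular_values F \<noteq> {#}" using sv(1) by force
    from gen[OF lt this] have "real n * (\<Sum>s\<in>#singular_values F. s\<^sup>2) < real n * frob2 F"
      using sv(1) by (simp add: sum_mset_distrib_left image_mset.compositionality comp_def)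
    then show False using sv(3) by simp
  qed
  then obtain s where s: "s \<in># singular_values F" "frob2 F \<le> real n * s\<^sup>2" by blast
  obtain z where z: "z \<in># proots (char_poly (mat_adjoint F * F))" "s = sqrt (Re z)"
    using s unfolding singular_values_def by auto
  have zs: "z = complex_of_real (s\<^sup>2)"
    using z proots_gram(1,2)[OF FC z(1)] by simp
  obtain v where v: "v \<in> carrier_vec n" "v \<noteq> 0\<^sub>v n" "F *\<^sub>v (F *\<^sub>v v) = complex_of_real (s\<^sup>2) \<cdot>\<^sub>v v"
    using proots_gram(3)[OF FC z(1)] unfolding adj zs by blast
  \<comment> \<open>If \<open>u\<close> is zero, \<open>v\<close> is an eigenvector for
    \<open>- s\<close>; otherwise \<open>u\<close> is one for \<open>s\<close>.\<close>
  define u where "u = F *\<^sub>v v + complex_of_real s \<cdot>\<^sub>v v"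
  have u: "u \<in> carrier_vec n" using FC v by (simp add: u_def)
  have "\<exists>x \<mu>. x \<in> carrier_vec n \<and> x \<noteq> 0\<^sub>v n \<and> \<mu>\<^sup>2 = s\<^sup>2 \<and> F *\<^sub>v x = complex_of_real \<mu> \<cdot>\<^sub>v x"
  proof (cases "u = 0\<^sub>v n")
    case True
    have "F *\<^sub>v v = complex_of_real (- s) \<cdot>\<^sub>v v"
    proof (rule eq_vecI)
      fix i assume "i < dim_vec (complex_of_real (- s) \<cdot>\<^sub>v v)"
      then have i: "i < n" using v by simp
      then have "u $ i = 0" using True by simp
      then have "(F *\<^sub>v v) $ i + complex_of_real s * v $ i = 0"
        using i v(1) FC unfolding u_def by (simp del: index_mult_mat_vec)
      then show "(F *\<^sub>v v) $ i = (complex_of_real (- s) \<cdot>\<^sub>v v) $ i"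
        using i v(1) by (simp add: add_eq_0_iff2 del: index_mult_mat_vec)
    qed (use FC v in auto)
    then show ?thesis using v by (intro exI[of _ v] exI[of _ "- s"]) auto
  next
    case False
    have "F *\<^sub>v u = F *\<^sub>v (F *\<^sub>v v) + F *\<^sub>v (complex_of_real s \<cdot>\<^sub>v v)"
      unfolding u_def using FC v by (intro mult_add_distrib_mat_vec) auto
    also have "F *\<^sub>v (complex_of_real s \<cdot>\<^sub>v v) = complex_of_real s \<cdot>\<^sub>v (F *\<^sub>v v)"
      using FC v by (intro mult_mat_vec) auto
    also have "F *\<^sub>v (F *\<^sub>v v) + complex_of_real s \<cdot>\<^sub>v (F *\<^sub>v v) = complex_of_real s \<cdot>\<^sub>v u"
      unfolding v(3) using FC v(1)
      by (intro eq_vecI) (auto simp: u_def algebra_simps power2_eq_square simp del: index_mult_mat_vec)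
    finally show ?thesis using False u by blast
  qed
  then obtain x \<mu> where x: "x \<in> carrier_vec n" "x \<noteq> 0\<^sub>v n" "\<mu>\<^sup>2 = s\<^sup>2" "F *\<^sub>v x = complex_of_real \<mu> \<cdot>\<^sub>v x"
    by blast
  define r where "r = sqrt (vnorm2 x)"
  have "vnorm2 x > 0" using x vnorm2_eq_0_iff[OF x(1)] vnorm2_nonneg[of x] by auto
  then have r: "r > 0" "r\<^sup>2 = vnorm2 x" by (auto simp: r_def)
  let ?v = "\<lambda>i. x $ i / complex_of_real r"
  have n1: "(\<Sum>i<n. (cmod (?v i))\<^sup>2) = 1"
  proof -
    have "(\<Sum>i<n. (cmod (?v i))\<^sup>2) = vnorm2 x / r\<^sup>2"
      using x(1) by (simp add: vnorm2_def norm_divide power_divide sum_divide_distrib)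
    then show ?thesis using r \<open>vnorm2 x > 0\<close> by simp
  qed
  have Fx: "(\<Sum>j<n. F $$ (i, j) * x $ j) = complex_of_real \<mu> * x $ i" if "i < n" for i
  proof -
    have "(F *\<^sub>v x) $ i = (\<Sum>j<n. F $$ (i, j) * x $ j)"
      using that FC x(1) by (simp add: scalar_prod_def atLeast0LessThan)
    then show ?thesis using x(1,4) that by simp
  qed
  have "quad_form n F ?v = (\<Sum>i<n. cnj (?v i) * (\<Sum>j<n. F $$ (i, j) * x $ j) / complex_of_real r)"
    unfolding quad_form_def by (simp add: sum_distrib_left sum_divide_distrib mult_ac)
  also have "\<dots> = (\<Sum>i<n. complex_of_real \<mu> * (?v i * cnj (?v i)))"
    by (intro sum.cong refl) (simp add: Fx)
  also have "\<dots> = complex_of_real (\<mu> * (\<Sum>i<n. (cmod (?v i))\<^sup>2))"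
    by (simp only: complex_norm_square[symmetric] sum_distrib_left of_real_sum of_real_mult)
  finally have "quad_form n F ?v = complex_of_real \<mu>" by (simp only: n1 mult_1_right)
  then show ?thesis using that n1 s(2) x(3) by simp
qed

section \<open>Upper bounds on the discrimination power\<close>

text \<open>The two losses of \<open>sqrt d\<close> meet here: one is in
  \<open>CDP_A_le_partial_tr\<close>, the other in \<open>frob2 F <= d * y^2\<close>.\<close>

lemma CDP_A_le_hermitian:
  assumes P: "hermitian_mat d F" and pos: "0 < frob2 F" and \<kappa>: "0 \<le> \<kappa>"
    and le: "frob2 (partial_tr d d F \<rho>) \<le> \<kappa>\<^sup>2 * frob2 F"
  shows "CDP_A d d \<rho> \<le> \<kappa> * real d"
proof -
  obtain v y where v: "(\<Sum>i<d. (cmod (v i))\<^sup>2) = 1" "quad_form d F v = complex_of_real y"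
    "frob2 F \<le> real d * y\<^sup>2"
    using hermitian_large_quad_form[OF P pos] .
  have y: "y \<noteq> 0" using v(3) pos by auto
  have d: "d > 0" using v(3) pos by (cases d) auto
  have "real d * frob2 (partial_tr d d F \<rho>) \<le> real d * (\<kappa>\<^sup>2 * (real d * y\<^sup>2))"
    using le v(3) by (intro mult_left_mono order_trans[OF le]) auto
  also have "\<dots> = (\<kappa> * real d * \<bar>y\<bar>)\<^sup>2" by (simp add: power2_eq_square)
  finally have "sqrt (real d * frob2 (partial_tr d d F \<rho>)) \<le> \<kappa> * real d * \<bar>y\<bar>"
    using \<kappa> by (intro real_le_lsqrt) auto
  then have "sqrt (real d * frob2 (partial_tr d d F \<rho>)) / \<bar>y\<bar> \<le> \<kappa> * real d"
    using y by (simp add: divide_le_eq)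
  then show ?thesis using CDP_A_le_partial_tr[OF P d v(1,2) y, of d \<rho>] by linarith
qed

lemma CDP_A_le_partial_tr_ratio:
  assumes R: "density_operator (d * d) \<rho>" and X: "X \<in> carrier_mat d d" "0 < frob2 X"
    and \<kappa>: "0 \<le> \<kappa>" and le: "frob2 (partial_tr d d X \<rho>) \<le> \<kappa>\<^sup>2 * frob2 X"
  shows "CDP_A d d \<rho> \<le> \<kappa> * real d"
proof -
  have "psd (d * d) \<rho>" using R by (simp add: density_operator_def)
  from hermitian_part[OF this X le] obtain H where
    "hermitian_mat d H" "0 < frob2 H" "frob2 (partial_tr d d H \<rho>) \<le> \<kappa>\<^sup>2 * frob2 H" by blast
  then show ?thesis by (rule CDP_A_le_hermitian[OF _ _ \<kappa>])
qed

lemma CDP_A_le_schmidt_coeff: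
  assumes R: "density_operator (d * d) \<rho>"
    and F: "hs_orthonormal_basis d F" and G: "hs_orthonormal_basis d G"
    and s: "s \<in># operator_schmidt_coeffs d F G \<rho>"
  shows "CDP_A d d \<rho> \<le> s * real d"
proof -
  let ?C = "correlation_matrix d F G \<rho>"
  have RC: "\<rho> \<in> carrier_mat (d * d) (d * d)" using R by (simp add: density_operator_def psd_def)
  have CC: "?C \<in> carrier_mat (d\<^sup>2) (d\<^sup>2)" by (simp add: correlation_matrix_def)
  have s': "s \<in># singular_values ?C" using s by (simp add: operator_schmidt_coeffs_def)
  obtain w where w: "w \<in> carrier_vec (d\<^sup>2)" "0 < vnorm2 w"
    "vnorm2 (mat_adjoint ?C *\<^sub>v w) = s\<^sup>2 * vnorm2 w"
    using singular_value_left_vector[OF CC s'] .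
  define X where "X = mat d d (\<lambda>(a, b). \<Sum>i<d\<^sup>2. w $ i * F i $$ (a, b))"
  note X = correlation_matrix_left_vector[OF F G RC w(1), folded X_def]
  show ?thesis
  proof (rule CDP_A_le_partial_tr_ratio[OF R])
    show "mat_adjoint X \<in> carrier_mat d d" by (simp add: X_def)
    show "0 < frob2 (mat_adjoint X)" "frob2 (partial_tr d d (mat_adjoint X) \<rho>) \<le> s\<^sup>2 * frob2 (mat_adjoint X)"
      using w X by (simp_all add: frob2_adjoint)
    show "0 \<le> s" by (rule singular_values_facts(2)[OF CC s'])
  qed
qed

text \<open>The extremal configuration gives all the slack to one index. For the excesses
  \<open>s i = r i - q\<close>, which are nonnegative, the sum of squares is at most the square of
  the sum, hence at most \<open>t^2\<close>.\<close>

lemma sum_squares_le: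
  fixes r :: "'a \<Rightarrow> real"
  assumes A: "finite A" "A \<noteq> {}" and q: "\<And>i. i \<in> A \<Longrightarrow> q \<le> r i" and le: "(\<Sum>i\<in>A. r i) \<le> 1" and "0 \<le> q"
  shows "(\<Sum>i\<in>A. (r i)\<^sup>2) \<le> (1 - (real (card A) - 1) * q)\<^sup>2 + (real (card A) - 1) * q\<^sup>2"
proof -
  let ?m = "real (card A)"
  define s where "s i = r i - q" for i
  define t where "t = 1 - ?m * q"
  have s: "0 \<le> s i" if "i \<in> A" for i using q[OF that] by (simp add: s_def)
  have sum: "(\<Sum>i\<in>A. s i) \<le> t" "0 \<le> (\<Sum>i\<in>A. s i)"
    using le s by (simp add: s_def t_def sum_subtractf, intro sum_nonneg)
  have "(\<Sum>i\<in>A. (s i)\<^sup>2) \<le> (\<Sum>i\<in>A. s i * (\<Sum>i\<in>A. s i))"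
    using A s by (intro sum_mono) (auto simp: power2_eq_square intro!: mult_left_mono member_le_sum)
  also have "\<dots> = (\<Sum>i\<in>A. s i)\<^sup>2" by (simp add: sum_distrib_right[symmetric] power2_eq_square)
  also have "\<dots> \<le> t\<^sup>2" using sum by (intro power_mono)
  finally have 1: "(\<Sum>i\<in>A. (s i)\<^sup>2) \<le> t\<^sup>2" .
  have 2: "2 * q * (\<Sum>i\<in>A. s i) \<le> 2 * q * t" using sum \<open>0 \<le> q\<close> by (intro mult_left_mono) auto
  have "(\<Sum>i\<in>A. (r i)\<^sup>2) = (\<Sum>i\<in>A. (s i)\<^sup>2 + 2 * q * s i + q\<^sup>2)"
    by (simp add: s_def power2_eq_square algebra_simps)
  also have "\<dots> = (\<Sum>i\<in>A. (s i)\<^sup>2) + 2 * q * (\<Sum>i\<in>A. s i) + ?m * q\<^sup>2"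
    by (simp add: sum.distrib sum_distrib_left)
  also have "\<dots> \<le> t\<^sup>2 + 2 * q * t + ?m * q\<^sup>2" using 1 2 by linarith
  also have "\<dots> = (1 - (?m - 1) * q)\<^sup>2 + (?m - 1) * q\<^sup>2"
    by (simp add: t_def power2_eq_square algebra_simps)
  finally show ?thesis .
qed

text \<open>The identity direction takes \<open>?b / d\<close>, at least \<open>1/d^2\<close>, of
  \<open>frob2 \<rho>\<close>; the \<open>d^2 - 1\<close> traceless directions share the rest, so
  one of them is at most the average.\<close>

lemma CDP_A_le_of_frob2:
  assumes d: "d \<ge> 2" and R: "density_operator (d * d) \<rho>"
    and S: "frob2 \<rho> \<le> 1 / (real d)\<^sup>2 + ((real d)\<^sup>2 - 1) * \<kappa>\<^sup>2" and \<kappa>: "0 \<le> \<kappa>"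
  shows "CDP_A d d \<rho> \<le> \<kappa> * real d"
proof -
  let ?b = "frob2 (partial_tr d d (1\<^sub>m d) \<rho>)"
  have RC: "\<rho> \<in> carrier_mat (d * d) (d * d)" using R by (simp add: density_operator_def psd_def)
  have N: "(real d)\<^sup>2 - 1 > 0" using d power_mono[of 2 "real d" 2] by simp
  obtain X where X: "X \<in> carrier_mat d d" "0 < frob2 X"
    "frob2 (partial_tr d d X \<rho>) \<le> (frob2 \<rho> - ?b / real d) / ((real d)\<^sup>2 - 1) * frob2 X"
    using exists_traceless_below_average[OF d RC] by metis
  have "1 / (real d)\<^sup>2 \<le> ?b / real d"
    using frob2_partial_tr_one[OF R] d by (simp add: field_simps power2_eq_square)
  then have "frob2 \<rho> - ?b / real d \<le> \<kappa>\<^sup>2 * ((real d)\<^sup>2 - 1)"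
    using S by (simp only: mult.commute[of "\<kappa>\<^sup>2"])
  then have "(frob2 \<rho> - ?b / real d) / ((real d)\<^sup>2 - 1) \<le> \<kappa>\<^sup>2"
    by (simp only: pos_divide_le_eq[OF N])
  then have "frob2 (partial_tr d d X \<rho>) \<le> \<kappa>\<^sup>2 * frob2 X"
    using X by (meson mult_right_mono order_trans less_imp_le)
  then show ?thesis using CDP_A_le_partial_tr_ratio[OF R X(1,2) \<kappa>] by simp
qed

lemma quad_form_add_scalar:
  assumes H: "H \<in> carrier_mat n n" and v: "(\<Sum>i<n. (cmod (v i))\<^sup>2) = 1"
  shows "quad_form n (H + c \<cdot>\<^sub>m 1\<^sub>m n) v = quad_form n H v + c"
proof -
  have "quad_form n (H + c \<cdot>\<^sub>m 1\<^sub>m n) v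
      = (\<Sum>i<n. \<Sum>j<n. cnj (v i) * H $$ (i, j) * v j + (if i = j then c * (v i * cnj (v i)) else 0))"
    unfolding quad_form_def using H by (intro sum.cong refl) (simp add: algebra_simps)
  also have "\<dots> = quad_form n H v + c * (\<Sum>i<n. v i * cnj (v i))"
    by (simp add: sum.distrib quad_form_def sum_distrib_left)
  also have "(\<Sum>i<n. v i * cnj (v i)) = complex_of_real (\<Sum>i<n. (cmod (v i))\<^sup>2)"
    by (simp add: complex_norm_square flip: of_real_power)
  finally show ?thesis using v by simp
qed

text \<open>Tilting the traceless \<open>H\<close> towards the identity enlarges its numerical radius by a larger
  factor than the norm of its image: the spectrum of \<open>H\<close> is symmetric, so the sign of the tilt is
  free and the cross term can be dropped. The ratio 1/9 of the two components is optimal for the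
  symmetric Werner state \<open>(1 + SWAP) / 6\<close>.\<close>

lemma CDP_A_qubit_tilted:
  assumes H: "hermitian_mat 2 H" "mtrace H = 0" "0 < frob2 H"
    and le: "frob2 (partial_tr 2 2 H \<rho>) \<le> \<alpha> * frob2 H"
    and \<beta>: "324 / 100 * (\<alpha> + frob2 (partial_tr 2 2 (1\<^sub>m 2) \<rho>) / 162) \<le> \<beta>\<^sup>2" "0 \<le> \<beta>"
  shows "CDP_A 2 2 \<rho> \<le> \<beta>"
proof -
  let ?T = "\<lambda>X. partial_tr 2 2 X \<rho>"
  let ?b = "frob2 (?T (1\<^sub>m 2))"
  have HC: "H \<in> carrier_mat 2 2" using H by (simp add: hermitian_mat_def)
  \<comment> \<open>The eigenvalues of \<open>H\<close> are \<open>9 t\<close> and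
    \<open>- 9 t\<close>. On the symmetric Werner state a tilt by \<open>c\<close> times the
    eigenvalue bounds the squared ratio by \<open>(1/9 + c^2) / (1 + c)^2\<close>, which is minimal
    at \<open>c = 1/9\<close> with value \<open>1/10\<close>.\<close>
  define t where "t = sqrt (frob2 H / 2) / 9"
  have t: "t > 0" "frob2 H = 162 * t\<^sup>2" using H(3) by (simp_all add: t_def power_divide)
  obtain v y where v: "(\<Sum>i<2. (cmod (v i))\<^sup>2) = 1" "quad_form 2 H v = complex_of_real y"
    "frob2 H \<le> real 2 * y\<^sup>2"
    using hermitian_large_quad_form[OF H(1,3)] .
  have "(9 * t)\<^sup>2 \<le> \<bar>y\<bar>\<^sup>2" using v(3) t(2) by (simp add: power2_eq_square)
  then have yt: "9 * t \<le> \<bar>y\<bar>" by (rule power2_le_imp_le) simp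
  \<comment> \<open>The unit vector orthogonal to \<open>v\<close>; since \<open>H\<close> is
    traceless, its expectation value is \<open>- y\<close>.\<close>
  define v' where "v' i = (if i = 0 then - cnj (v 1) else cnj (v 0))" for i :: nat
  have two: "{..<2} = {0, 1 :: nat}" by auto
  have v': "(\<Sum>i<2. (cmod (v' i))\<^sup>2) = 1" "quad_form 2 H v' = complex_of_real (- y)"
  proof -
    show "(\<Sum>i<2. (cmod (v' i))\<^sup>2) = 1" using v(1) by (simp add: two v'_def add.commute)
    have tr: "H $$ (Suc 0, Suc 0) = - H $$ (0, 0)"
      using H(2) HC by (simp add: mtrace_def two add_eq_0_iff)
    have "quad_form 2 H v' + quad_form 2 H v = 0"
      by (simp add: quad_form_def two v'_def tr algebra_simps)
    then show "quad_form 2 H v' = complex_of_real (- y)"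
      using v(2) by (simp add: add_eq_0_iff2)
  qed
  let ?P = "H + complex_of_real t \<cdot>\<^sub>m 1\<^sub>m 2" and ?M = "H + complex_of_real (- t) \<cdot>\<^sub>m 1\<^sub>m 2"
  have TP: "?T ?P = ?T H + complex_of_real t \<cdot>\<^sub>m ?T (1\<^sub>m 2)"
    using HC by (simp add: partial_tr_add[of _ 2] partial_tr_smult[of _ 2])
  have TM: "?T ?M = ?T H + (- 1) \<cdot>\<^sub>m (complex_of_real t \<cdot>\<^sub>m ?T (1\<^sub>m 2))"
    using HC by (intro eq_matI) (simp_all add: partial_tr_add[of _ 2] partial_tr_smult[of _ 2])
  \<comment> \<open>The cross terms of the two tilts are opposite, so for one sign the cross term
    does not increase the norm. That sign is then matched by choosing between \<open>v\<close> and
    \<open>v'\<close>, so that the shift adds to \<open>|y|\<close>.\<close>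
  have "frob2 (?T ?P) + frob2 (?T ?M) = 2 * frob2 (?T H) + 2 * (t\<^sup>2 * ?b)"
    unfolding TP TM
    using frob2_parallelogram[of "?T H" 2 2 "complex_of_real t \<cdot>\<^sub>m ?T (1\<^sub>m 2)"]
    by (simp add: frob2_smult)
  then have "frob2 (?T ?P) \<le> frob2 (?T H) + t\<^sup>2 * ?b \<or> frob2 (?T ?M) \<le> frob2 (?T H) + t\<^sup>2 * ?b"
    by linarith
  then obtain \<sigma> :: real where \<sigma>: "\<sigma> = 1 \<or> \<sigma> = - 1"
    and f: "frob2 (?T (H + complex_of_real (\<sigma> * t) \<cdot>\<^sub>m 1\<^sub>m 2)) \<le> frob2 (?T H) + t\<^sup>2 * ?b"
    by (metis mult_1 mult_minus1)
  let ?K = "H + complex_of_real (\<sigma> * t) \<cdot>\<^sub>m 1\<^sub>m 2"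
  have K: "hermitian_mat 2 ?K"
    unfolding hermitian_mat_def
  proof (intro conjI allI impI)
    fix i j :: nat assume ij: "i < 2" "j < 2"
    then have "H $$ (j, i) = cnj (H $$ (i, j))" using H(1) unfolding hermitian_mat_def by blast
    then have "cnj (H $$ (i, j)) = H $$ (j, i)" by (rule sym)
    then show "?K $$ (j, i) = cnj (?K $$ (i, j))" using HC ij by (cases "i = j") auto
  qed (use HC in simp)
  define z where "z = \<sigma> * (\<bar>y\<bar> + t)"
  have z: "\<bar>z\<bar> = \<bar>y\<bar> + t" using \<sigma> t by (auto simp: z_def)
  have "\<sigma> * \<bar>y\<bar> = y \<or> \<sigma> * \<bar>y\<bar> = - y" using \<sigma> by (auto simp: abs_if)
  then obtain u where u: "(\<Sum>i<2. (cmod (u i))\<^sup>2) = 1" "quad_form 2 H u = complex_of_real (\<sigma> * \<bar>y\<bar>)"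
    using v v' by metis
  have qz: "quad_form 2 ?K u = complex_of_real z"
    by (simp add: quad_form_add_scalar[OF HC u(1)] u(2) z_def distrib_left)
  have "CDP_A 2 2 \<rho> \<le> sqrt (real 2 * frob2 (?T ?K)) / \<bar>z\<bar>"
    by (rule CDP_A_le_partial_tr[OF K _ u(1) qz]) (use z t in auto)
  also have "\<dots> \<le> \<beta>"
  proof -
    have "2 * frob2 (?T ?K) \<le> 2 * (\<alpha> * (162 * t\<^sup>2) + t\<^sup>2 * ?b)" using f le t by simp
    \<comment> \<open>Here \<open>324 / 100\<close> is \<open>2 * 162 / 10^2\<close>:
      \<open>162 t^2\<close> is \<open>frob2 H\<close>, and \<open>10 t = 9 t + t\<close> bounds
      \<open>|z|\<close> from below.\<close>
    also have "\<dots> = 324 / 100 * (\<alpha> + ?b / 162) * (10 * t)\<^sup>2" by (simp add: power2_eq_square algebra_simps)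
    also have "\<dots> \<le> \<beta>\<^sup>2 * (10 * t)\<^sup>2" using \<beta> by (intro mult_right_mono) auto
    also have "\<dots> = (\<beta> * (10 * t))\<^sup>2" by (simp add: power_mult_distrib)
    finally have "sqrt (real 2 * frob2 (?T ?K)) \<le> \<beta> * (10 * t)"
      using \<beta>(2) t by (intro real_le_lsqrt) auto
    also have "\<dots> \<le> \<beta> * \<bar>z\<bar>" using \<beta>(2) z yt by (intro mult_left_mono) auto
    finally have "sqrt (real 2 * frob2 (?T ?K)) \<le> \<beta> * \<bar>z\<bar>" .
    moreover have "0 < \<bar>z\<bar>" using z t by linarith
    ultimately show ?thesis by (simp only: pos_divide_le_eq)
  qed
  finally show ?thesis .
qed

text \<open>With \<open>q = 41 / 250\<close>, the hypothesis is the bound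
  \<open>(1 - 3 q)^2 + 3 q^2\<close> of \<open>sum_squares_le\<close>, and the conclusion is
  \<open>2 q\<close>.\<close>

lemma CDP_A_qubit_le_of_frob2:
  assumes R: "density_operator (2 * 2) \<rho>" and S: "frob2 \<rho> \<le> 338752 / 1000000"
  shows "CDP_A 2 2 \<rho> \<le> 41 / 125"
proof -
  let ?b = "frob2 (partial_tr 2 2 (1\<^sub>m 2) \<rho>)"
  have P: "psd (2 * 2) \<rho>" and RC: "\<rho> \<in> carrier_mat (2 * 2) (2 * 2)"
    using R by (simp_all add: density_operator_def psd_def)
  obtain X where X: "X \<in> carrier_mat 2 2" "mtrace X = 0" "0 < frob2 X"
    "frob2 (partial_tr 2 2 X \<rho>) \<le> (frob2 \<rho> - ?b / real 2) / ((real 2)\<^sup>2 - 1) * frob2 X"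
    using exists_traceless_below_average[OF order_refl RC] .
  obtain H where H: "hermitian_mat 2 H" "0 < frob2 H"
    "frob2 (partial_tr 2 2 H \<rho>) \<le> (frob2 \<rho> - ?b / real 2) / ((real 2)\<^sup>2 - 1) * frob2 H" "mtrace H = 0"
    using hermitian_part[OF P X(1,3,4)] X(2) by metis
  have "1 / 2 \<le> ?b" using frob2_partial_tr_one[OF R] by simp
  \<comment> \<open>The left side decreases in \<open>?b\<close>, with slope proportional to
    \<open>1/162 - 1/6\<close>, so \<open>?b = 1/2\<close> is the worst case.\<close>
  then have "324 / 100 * ((frob2 \<rho> - ?b / real 2) / ((real 2)\<^sup>2 - 1) + ?b / 162) \<le> (41 / 125)\<^sup>2"
    using S by (simp add: power2_eq_square field_simps)
  then show ?thesis by (intro CDP_A_qubit_tilted[OF H(1,4,2,3)]) auto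
qed

section \<open>Numerical estimates of \<open>r_CN\<close>\<close>

lemma r_CN_2_ge: "41 / 250 \<le> r_CN 2"
proof -
  \<comment> \<open>\<open>r_CN 2\<close> is \<open>(6 - sqrt 3) / 26\<close>, and
    \<open>6 - 26 * 41 / 250 = 1.736\<close>.\<close>
  have "sqrt 3 \<le> 1736 / 1000" by (rule real_le_lsqrt) (auto simp: power2_eq_square)
  then show ?thesis by (simp add: r_CN_def)
qed

lemma r_CN_ge:
  assumes d: "d \<ge> 3"
  shows "1 / (real d * (real d + 1)) \<le> r_CN d"
proof -
  define x where "x = real d"
  have x: "x \<ge> 3" using d by (simp add: x_def)
  have s: "sqrt (x\<^sup>2 - 1) \<le> x" using x by (intro real_le_lsqrt) auto
  have D: "x * (x\<^sup>2 - 1)\<^sup>2 + x ^ 3 > 0" using x by (intro add_nonneg_pos) auto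
  have "3 * x\<^sup>2 \<le> x * x\<^sup>2" "3 * x \<le> x\<^sup>2"
    using x by (auto simp: power2_eq_square intro!: mult_right_mono)
  \<comment> \<open>After \<open>sqrt (x^2 - 1)\<close> is replaced by \<open>x\<close>, clearing
    denominators leaves \<open>x\<close> times \<open>x^3 - x^2 - 2 x - 1 >= 0\<close>. This fails
    at \<open>x = 2\<close>.\<close>
  then have poly: "x\<^sup>2 + 2 * x + 1 \<le> x * x\<^sup>2" using x by linarith
  have "x * (x\<^sup>2 - 1)\<^sup>2 + x ^ 3 \<le> (x * (x\<^sup>2 - 1) - x) * (x * (x + 1))"
    using mult_left_mono[OF poly, of x] x by (simp add: power2_eq_square power3_eq_cube algebra_simps)
  also have "\<dots> \<le> (x * (x\<^sup>2 - 1) - sqrt (x\<^sup>2 - 1)) * (x * (x + 1))"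
    using s x by (intro mult_right_mono) auto
  finally have "1 / (x * (x + 1)) \<le> (x * (x\<^sup>2 - 1) - sqrt (x\<^sup>2 - 1)) / (x * (x\<^sup>2 - 1)\<^sup>2 + x ^ 3)"
    using D x by (subst frac_le_eq) (auto simp: divide_le_0_iff mult.commute)
  then show ?thesis by (simp add: r_CN_def x_def)
qed

lemma r_CN_less:
  assumes d: "d \<ge> 2"
  shows "r_CN d * real d < 1 / real d"
proof -
  define x where "x = real d"
  have x: "x \<ge> 2" using d by (simp add: x_def)
  have "2\<^sup>2 \<le> x\<^sup>2" using x by (intro power_mono) auto
  then have s: "0 \<le> sqrt (x\<^sup>2 - 1)" by simp
  have D: "x * (x\<^sup>2 - 1)\<^sup>2 + x ^ 3 > 0" using x by (intro add_nonneg_pos) auto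
  have "(x * (x\<^sup>2 - 1) - sqrt (x\<^sup>2 - 1)) * x * x \<le> x * (x\<^sup>2 - 1) * x * x"
    using s x by (intro mult_right_mono) auto
  \<comment> \<open>The two sides differ by exactly \<open>x\<close>.\<close>
  also have "\<dots> < x * (x\<^sup>2 - 1)\<^sup>2 + x ^ 3"
    using x by (simp add: power2_eq_square power3_eq_cube algebra_simps)
  finally have "(x * (x\<^sup>2 - 1) - sqrt (x\<^sup>2 - 1)) / (x * (x\<^sup>2 - 1)\<^sup>2 + x ^ 3) * x < 1 / x"
    using D x by (simp add: field_simps)
  then show ?thesis by (simp add: r_CN_def x_def)
qed

theorem mainTheorem4:
  fixes d :: nat and \<rho> :: "complex mat"
    and F G :: "nat \<Rightarrow> complex mat" and r :: "nat \<Rightarrow> real"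
  assumes "d \<ge> 2"
    and "density_operator (d * d) \<rho>"
    and "hs_orthonormal_basis d F" and "hs_orthonormal_basis d G"
    and "image_mset r (mset_set {1..d^2}) = operator_schmidt_coeffs d F G \<rho>"
    and "\<forall>i j. 1 \<le> i \<and> i \<le> j \<and> j \<le> d^2 \<longrightarrow> r i \<ge> r j"
    and "(\<Sum>i = 1..d^2. r i) \<le> 1"
  shows "CDP_A d d \<rho> \<le> r_CN d * real d \<and> r_CN d * real d < 1 / real d"
proof
  note d = assms(1) and R = assms(2) and F = assms(3) and G = assms(4) and r = assms(5)
  show "r_CN d * real d < 1 / real d" using r_CN_less[OF d] .
  let ?C = "correlation_matrix d F G \<rho>"
  have RC: "\<rho> \<in> carrier_mat (d * d) (d * d)" using R by (simp add: density_operator_def psd_def)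
  have CC: "?C \<in> carrier_mat (d\<^sup>2) (d\<^sup>2)" by (simp add: correlation_matrix_def)
  have S: "frob2 \<rho> = (\<Sum>i = 1..d\<^sup>2. (r i)\<^sup>2)"
  proof -
    have "frob2 \<rho> = (\<Sum>s\<in>#image_mset r (mset_set {1..d\<^sup>2}). s\<^sup>2)"
      using singular_values_facts(3)[OF CC] frob2_correlation_matrix[OF F G RC] r
      by (simp add: operator_schmidt_coeffs_def)
    then show ?thesis by (simp add: sum_unfold_sum_mset image_mset.compositionality comp_def)
  qed
  \<comment> \<open>For \<open>d = 2\<close> the value \<open>1/6\<close> exceeds
    \<open>r_CN 2\<close>, so a rational just below \<open>r_CN 2\<close> replaces it. In all cases
    \<open>q <= r_CN d\<close>, so \<open>q\<close> bounds every coefficient from below when none is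
    at most \<open>r_CN d\<close>.\<close>
  define q where "q = (if d = 2 then 41 / 250 else 1 / (real d * (real d + 1)))"
  have q: "0 \<le> q" "q \<le> r_CN d"
    using d r_CN_2_ge r_CN_ge[of d] by (auto simp: q_def)
  show "CDP_A d d \<rho> \<le> r_CN d * real d"
  proof (cases "\<exists>i\<in>{1..d\<^sup>2}. r i \<le> r_CN d")
    case True
    then obtain i where i: "i \<in> {1..d\<^sup>2}" "r i \<le> r_CN d" by blast
    then have "r i \<in># operator_schmidt_coeffs d F G \<rho>" unfolding r[symmetric] by simp
    then have "CDP_A d d \<rho> \<le> r i * real d" by (rule CDP_A_le_schmidt_coeff[OF R F G])
    also have "\<dots> \<le> r_CN d * real d" using i by (intro mult_right_mono) auto
    finally show ?thesis .
  next
    case False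
    then have "q \<le> r i" if "i \<in> {1..d\<^sup>2}" for i using that q by force
    then have Sq: "frob2 \<rho> \<le> (1 - ((real d)\<^sup>2 - 1) * q)\<^sup>2 + ((real d)\<^sup>2 - 1) * q\<^sup>2"
      unfolding S using sum_squares_le[of "{1..d\<^sup>2}" q r] assms(7) q d by simp
    show ?thesis
    proof (cases "d = 2")
      case True
      have "frob2 \<rho> \<le> 338752 / 1000000" using Sq True by (simp add: q_def power2_eq_square)
      then have "CDP_A 2 2 \<rho> \<le> 41 / 125" using R True by (intro CDP_A_qubit_le_of_frob2) auto
      then show ?thesis using r_CN_2_ge True by simp
    next
      case False
      then have qd: "q = 1 / (real d * (real d + 1))" by (simp add: q_def)
      \<comment> \<open>The largest coefficient of the extremal configuration; its square is the
        first term required by \<open>CDP_A_le_of_frob2\<close>.\<close>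
      have "1 - ((real d)\<^sup>2 - 1) * q = 1 / real d"
      proof -
        have "(real d)\<^sup>2 - 1 = (real d - 1) * (real d + 1)" by (simp add: power2_eq_square algebra_simps)
        then have "((real d)\<^sup>2 - 1) * q = (real d - 1) / real d" using d by (simp add: qd)
        then show ?thesis using d by (simp add: diff_divide_distrib)
      qed
      then have "frob2 \<rho> \<le> 1 / (real d)\<^sup>2 + ((real d)\<^sup>2 - 1) * q\<^sup>2"
        using Sq by (simp add: power_divide)
      then have "CDP_A d d \<rho> \<le> q * real d" using CDP_A_le_of_frob2[OF d R _ q(1)] by simp
      also have "\<dots> \<le> r_CN d * real d" using q by (intro mult_right_mono) auto
      finally show ?thesis .
    qed
  qed
qed

end
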